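(* Let $m>0$ and let $\widetilde{\mathcal S}=\{F_j(y,y',\ldots,y^{(m)})=0\}_{1\le j\le M}$ with $F_1,\ldots,F_M\in\mathbb{C}[y,y',\ldots,y^{(m)}]$ be a finite system of autonomous algebraic ordinary differential equations whose associated algebraic set $\mathbb{V}_{\mathbb{C}}(\widetilde{\mathcal S})\subseteq\mathbb{C}^{m+1}$ has dimension one. Let $y(x)$ be a non-constant formal Puiseux series solution of $\widetilde{\mathcal S}$ that is algebraic over $\mathbb{C}(x)$, and let $H$ be the reduced differential equation of $\widetilde{\mathcal S}$. Then the minimal polynomial $G(x,Y)$ of $y(x)$ fulfills the degree bounds $$\deg_x(G)\le\deg_{y'}(H)\quad\text{and}\quad \deg_Y(G)\le\deg_y(H)+\deg_{y'}(H).$$ In particular, if $y(x)$ is a rational solution of $\widetilde{\mathcal S}$, then its degree, i.e. the maximum of the degrees of its numerator and denominator, is less than or equal to $\deg_{y'}(H)$.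
   Context: Conventions. $\mathbb{V}_K(\cdot)$ denotes the common zeros in $K^{m+1}$ of a set of polynomials in $y,y',\ldots,y^{(m)}$, regarded as independent variables. A formal Puiseux series around $x_0\in\mathbb{C}$ is $\sum_{j\ge p}c_j(x-x_0)^{j/n}$ ($p\in\mathbb{Z}$, $n\in\mathbb{Z}_{>0}$, $c_j\in\mathbb{C}$), at infinity $\sum_{j\ge p}c_jx^{-j/n}$, with term-by-term derivation in $x$. The minimal polynomial of an algebraic $y(x)$ is an irreducible $G\in\mathbb{C}[x,Y]$ with $G(x,y(x))=0$. Regular chains. Order the variables $y<y'<\cdots<y^{(m)}$. For a non-constant polynomial $f$, its leading variable $\mathrm{lv}(f)$ is the largest variable occurring in it, and its initial $\mathrm{init}(f)$ is its leading coefficient with respect to $\mathrm{lv}(f)$. A system $\mathcal S=\{F_1,\ldots,F_k\}$ with $\mathrm{lv}(F_1)<\cdots<\mathrm{lv}(F_k)$ is a regular chain if for every $f\in\{\mathrm{init}(F_1),\ldots,\mathrm{init}(F_k)\}$ the iterated resultant $\mathrm{Res}_{\mathrm{lv}(F_1)}(\cdots\mathrm{Res}_{\mathrm{lv}(F_k)}(f,F_k)\cdots,F_1)$ is nonzero. Put $\mathrm{pinit}(\mathcal S)=\prod_j\mathrm{init}(F_j)$. Decomposition. There are finitely many regular chains $\mathcal S_1,\ldots,\mathcal S_N$ with $\mathbb{V}_K(\widetilde{\mathcal S})=\bigcup_{j}\mathbb{V}_K(\mathcal S_j)\setminus\mathbb{V}_K(\mathrm{pinit}(\mathcal S_j))$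 for fields $K\supseteq\mathbb{C}$. Fix such a decomposition and discard all chains that start with a polynomial in $\mathbb{C}[y]$. Each remaining chain has the form $\mathcal S=\{G_1(y,y'),G_2(y,y',y''),\ldots,G_m(y,\ldots,y^{(m)})\}$, where $G_i$ has degree $r_i\ge1$ in $y^{(i)}$. Write $u_i$ for $y^{(i)}$. In each chain, $G_1\in\mathbb{C}[u_0,u_1]$ is taken to be square-free and with no (non-constant) factor in $\mathbb{C}[u_0]$ or $\mathbb{C}[u_1]$. Reduced differential equation of a chain $\mathcal S$. For $j\ge2$ the $(j-1)$-st total derivative of $G_1(y,y')$ has the form $G_1^{(j-1)}=\frac{\partial G_1}{\partial u_1}(y,y')\,y^{(j)}+R_{j-1}(y,\ldots,y^{(j-1)})$. Put $A_j(u_0,\ldots,u_{j-1})=-R_{j-1}(u_0,\ldots,u_{j-1})/\frac{\partial G_1}{\partial u_1}(u_0,u_1)$ for $2\le j\le m$, and recursively $B_2=A_2(u_0,u_1)$, $B_j=A_j(u_0,u_1,B_2,\ldots,B_{j-1})\in\mathbb{C}(u_0,u_1)$. Let $H_1=G_1(u_0,u_1)$ and let $H_j\in\mathbb{C}[u_0,u_1]$ be the numerator of $G_j(u_0,u_1,B_2,\ldots,B_j)$ for $2\le j\le m$. The reduced differential equation of $\mathcal S$ is $\gcd(H_1,\ldots,H_m)(y,y')=0$. Reduced differential equation of $\widetilde{\mathcal S}$. It is $H(y,y')=0$, where $H$ is the least common multiple of the polynomials $\gcd(H_1,\ldots,H_m)$ obtained from the remaining chains ($H=1$ if there are none); the polynomial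 $H$ is also referred to as the reduced differential equation. *)

theory Defs
  imports
    "HOL-Library.Poly_Mapping"
    "HOL-Library.FuncSet"
    "HOL-Library.Extended_Nat"
    "HOL-Algebra.Algebraic_Closure_Type"
    "Subresultants.Resultant_Prelim"
    "HOL-Computational_Algebra.Computational_Algebra"
    "HOL-Computational_Algebra.Field_as_Ring"
begin

text \<open>
  An element of \<open>\<complex>[y, y', y'', \<dots>]\<close>; the variable with index \<open>i\<close> stands for
  \<open>u\<^sub>i = y\<^sup>(\<^sup>i\<^sup>)\<close>. A polynomial lies in \<open>\<complex>[y, \<dots>, y\<^sup>(\<^sup>m\<^sup>)]\<close> iff its \<open>mp_vars\<close> are contained in \<open>{..m}\<close>.
\<close>
type_synonym dpoly = "(nat \<Rightarrow>\<^sub>0 nat) \<Rightarrow>\<^sub>0 complex"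

definition mp_vars :: "dpoly \<Rightarrow> nat set" where
  "mp_vars p = (\<Union>k\<in>Poly_Mapping.keys p. Poly_Mapping.keys k)"

definition mp_const :: "complex \<Rightarrow> dpoly" where
  "mp_const c = Poly_Mapping.single 0 c"

definition mp_var :: "nat \<Rightarrow> dpoly" where
  "mp_var i = Poly_Mapping.single (Poly_Mapping.single i 1) 1"

definition mp_eval :: "(complex \<Rightarrow> 'a::comm_ring_1) \<Rightarrow> (nat \<Rightarrow> 'a) \<Rightarrow> dpoly \<Rightarrow> 'a" where
  "mp_eval \<iota> a p = (\<Sum>k\<in>Poly_Mapping.keys p. \<iota> (Poly_Mapping.lookup p k) *
     (\<Prod>i\<in>Poly_Mapping.keys k. a i ^ Poly_Mapping.lookup k i))"

text \<open>The polynomial \<open>p\<close> as a univariate polynomial in \<open>u\<^sub>i\<close>.\<close>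
definition mp_upoly :: "nat \<Rightarrow> dpoly \<Rightarrow> dpoly poly" where
  "mp_upoly i = mp_eval (\<lambda>c. [:mp_const c:]) (\<lambda>j. if j = i then [:0, 1:] else [:mp_var j:])"

definition mp_degree :: "nat \<Rightarrow> dpoly \<Rightarrow> nat" where
  "mp_degree i p = Polynomial.degree (mp_upoly i p)"

definition mp_pderiv :: "nat \<Rightarrow> dpoly \<Rightarrow> dpoly" where
  "mp_pderiv i p = poly (Polynomial.pderiv (mp_upoly i p)) (mp_var i)"

definition total_deriv :: "dpoly \<Rightarrow> dpoly" where
  "total_deriv p = (\<Sum>i\<in>mp_vars p. mp_pderiv i p * mp_var (Suc i))"

definition eval_in :: "'k ring \<Rightarrow> (complex \<Rightarrow> 'k) \<Rightarrow> (nat \<Rightarrow> 'k) \<Rightarrow> dpoly \<Rightarrow> 'k" where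
  "eval_in K \<iota> a p = (\<Oplus>\<^bsub>K\<^esub>k\<in>Poly_Mapping.keys p. \<iota> (Poly_Mapping.lookup p k) \<otimes>\<^bsub>K\<^esub>
     (\<Otimes>\<^bsub>K\<^esub>i\<in>Poly_Mapping.keys k. a i [^]\<^bsub>K\<^esub> Poly_Mapping.lookup k i))"

text \<open>
  The zero set in \<open>K\<^sup>m\<^sup>+\<^sup>1\<close>, where \<open>\<iota>\<close> embeds \<open>\<complex>\<close> into \<open>K\<close>. A point is an extensional function on
  \<open>{..m}\<close>.
\<close>
definition zeros :: "'k ring \<Rightarrow> (complex \<Rightarrow> 'k) \<Rightarrow> nat \<Rightarrow> dpoly set \<Rightarrow> (nat \<Rightarrow> 'k) set" where
  "zeros K \<iota> m S = {a \<in> {..m} \<rightarrow>\<^sub>E carrier K. \<forall>p\<in>S. eval_in K \<iota> a p = \<zero>\<^bsub>K\<^esub>}"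

abbreviation complex_ring :: "complex ring" where
  "complex_ring \<equiv> ring_of_type_algebra"

definition zariski_closed :: "nat \<Rightarrow> (nat \<Rightarrow> complex) set \<Rightarrow> bool" where
  "zariski_closed m Z \<longleftrightarrow>
     (\<exists>S. (\<forall>p\<in>S. mp_vars p \<subseteq> {..m}) \<and> Z = zeros complex_ring id m S)"

definition irreducible_closed :: "nat \<Rightarrow> (nat \<Rightarrow> complex) set \<Rightarrow> bool" where
  "irreducible_closed m Z \<longleftrightarrow> zariski_closed m Z \<and> Z \<noteq> {} \<and>
     (\<forall>A B. zariski_closed m A \<and> zariski_closed m B \<and> Z = A \<union> B \<longrightarrow> Z = A \<or> Z = B)"

text \<open>Krull dimension in the Zariski topology of \<open>\<complex>\<^sup>m\<^sup>+\<^sup>1\<close> (the empty set gets the value 0).\<close>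
definition alg_dim :: "nat \<Rightarrow> (nat \<Rightarrow> complex) set \<Rightarrow> enat" where
  "alg_dim m V = Sup {enat n | n. \<exists>Z :: nat \<Rightarrow> (nat \<Rightarrow> complex) set.
     (\<forall>i\<le>n. irreducible_closed m (Z i) \<and> Z i \<subseteq> V) \<and> (\<forall>i<n. Z i \<subset> Z (Suc i))}"

definition leading_var :: "dpoly \<Rightarrow> nat" where
  "leading_var p = Max (mp_vars p)"

definition initial :: "dpoly \<Rightarrow> dpoly" where
  "initial p = Polynomial.lead_coeff (mp_upoly (leading_var p) p)"

definition mp_resultant :: "nat \<Rightarrow> dpoly \<Rightarrow> dpoly \<Rightarrow> dpoly" where
  "mp_resultant i f g = resultant (mp_upoly i f) (mp_upoly i g)"

definition iterated_resultant :: "dpoly \<Rightarrow> dpoly list \<Rightarrow> dpoly" where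
  "iterated_resultant f C = foldr (\<lambda>F r. mp_resultant (leading_var F) r F) C f"

definition regular_chain :: "dpoly list \<Rightarrow> bool" where
  "regular_chain C \<longleftrightarrow>
     (\<forall>F\<in>set C. mp_vars F \<noteq> {}) \<and>
     sorted_wrt (\<lambda>F F'. leading_var F < leading_var F') C \<and>
     (\<forall>F\<in>set C. iterated_resultant (initial F) C \<noteq> 0)"

definition pinit :: "dpoly list \<Rightarrow> dpoly" where
  "pinit C = (\<Prod>F\<leftarrow>C. initial F)"

text \<open>
  The fields \<open>K \<supseteq> \<complex>\<close> are the fields whose carrier is a set of elements of the type of formal
  Laurent series, together with an embedding of \<open>\<complex>\<close>. HOL cannot quantify over types, but this loses
  nothing: a point of \<open>K\<^sup>m\<^sup>+\<^sup>1\<close> has its coordinates in a finitely generated extension of \<open>\<complex>\<close>, which has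
  the cardinality of the continuum and hence an isomorphic copy inside this type.
\<close>
definition is_decomposition :: "nat \<Rightarrow> dpoly set \<Rightarrow> dpoly list set \<Rightarrow> bool" where
  "is_decomposition m S CS \<longleftrightarrow>
     finite CS \<and>
     (\<forall>C\<in>CS. regular_chain C \<and> (\<forall>F\<in>set C. mp_vars F \<subseteq> {..m})) \<and>
     (\<forall>(K :: complex fls ring) \<iota>. Ring.field K \<and> \<iota> \<in> Ring.ring_hom complex_ring K \<longrightarrow>
        zeros K \<iota> m S = (\<Union>C\<in>CS. zeros K \<iota> m (set C) - zeros K \<iota> m {pinit C}))"

definition remaining_chains :: "dpoly list set \<Rightarrow> dpoly list set" where
  "remaining_chains CS = {C \<in> CS. \<not> (C \<noteq> [] \<and> mp_vars (hd C) \<subseteq> {0})}"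

text \<open>The polynomial \<open>G\<^sub>i\<close> is the list element with index \<open>i - 1\<close>.\<close>
definition has_chain_form :: "nat \<Rightarrow> dpoly list \<Rightarrow> bool" where
  "has_chain_form m C \<longleftrightarrow> length C = m \<and>
     (\<forall>i\<in>{1..m}. mp_vars (C ! (i - 1)) \<subseteq> {..i} \<and> mp_degree i (C ! (i - 1)) \<ge> 1)"

text \<open>
  Elements of \<open>\<complex>[u\<^sub>0, u\<^sub>1]\<close> are represented in \<open>complex poly poly\<close>: the outer variable is \<open>u\<^sub>1\<close>, the
  coefficients are polynomials in \<open>u\<^sub>0\<close>. Likewise \<open>\<complex>[x, Y]\<close> has the outer variable \<open>Y\<close>.
\<close>
definition to_bivariate :: "dpoly \<Rightarrow> complex poly poly" where
  "to_bivariate = mp_eval (\<lambda>c. [:[:c:]:])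
     (\<lambda>i. if i = 0 then [:[:0, 1:]:] else if i = 1 then [:0, 1:] else 0)"

definition inner_degree :: "complex poly poly \<Rightarrow> nat" where
  "inner_degree P = Max ((\<lambda>i. Polynomial.degree (Polynomial.coeff P i)) ` {..Polynomial.degree P})"

definition outer_degree :: "complex poly poly \<Rightarrow> nat" where
  "outer_degree P = Polynomial.degree P"

text \<open>The factors in \<open>\<complex>[u\<^sub>0]\<close> are the \<open>[:a:]\<close>, those in \<open>\<complex>[u\<^sub>1]\<close> have constant coefficients.\<close>
definition normalized_first :: "dpoly \<Rightarrow> bool" where
  "normalized_first G1 \<longleftrightarrow>
     squarefree (to_bivariate G1) \<and>
     (\<forall>a :: complex poly. [:a:] dvd to_bivariate G1 \<longrightarrow> Polynomial.degree a = 0) \<and>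
     (\<forall>b :: complex poly. map_poly (\<lambda>c. [:c:]) b dvd to_bivariate G1 \<longrightarrow> Polynomial.degree b = 0)"

text \<open>
  The normalization is imposed on the very chains that decompose \<open>S\<close>: a chain must not be altered
  by dropping factors afterwards, since dropping one in \<open>\<complex>[u\<^sub>1]\<close> would lose solutions \<open>c x + d\<close>.
\<close>
definition admissible_decomposition :: "nat \<Rightarrow> dpoly set \<Rightarrow> dpoly list set \<Rightarrow> bool" where
  "admissible_decomposition m S CS \<longleftrightarrow>
     is_decomposition m S CS \<and>
     (\<forall>C\<in>remaining_chains CS. has_chain_form m C \<and> normalized_first (hd C))"

text \<open>\<open>G1\<^sup>(\<^sup>k\<^sup>) = \<partial>G1/\<partial>u\<^sub>1 \<sqdot> u\<^sub>k\<^sub>+\<^sub>1 + R\<^sub>k\<close>\<close>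
definition deriv_rest :: "dpoly \<Rightarrow> nat \<Rightarrow> dpoly" where
  "deriv_rest G1 k = (total_deriv ^^ k) G1 - mp_pderiv 1 G1 * mp_var (Suc k)"

text \<open>
  \<open>B\<^sub>0 = u\<^sub>0\<close>, \<open>B\<^sub>1 = u\<^sub>1\<close>, and for \<open>j \<ge> 2\<close> the rational function \<open>B\<^sub>j = A\<^sub>j(u\<^sub>0, u\<^sub>1, B\<^sub>2, \<dots>, B\<^sub>j\<^sub>-\<^sub>1)\<close> with
  \<open>A\<^sub>j = -R\<^sub>j\<^sub>-\<^sub>1 / (\<partial>G1/\<partial>u\<^sub>1)\<close>.
\<close>
fun subst_B :: "dpoly \<Rightarrow> nat \<Rightarrow> complex poly poly fract" where
  "subst_B G1 0 = to_fract [:[:0, 1:]:]"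
| "subst_B G1 (Suc 0) = to_fract [:0, 1:]"
| "subst_B G1 (Suc (Suc k)) =
     - mp_eval (\<lambda>c. to_fract [:[:c:]:]) (\<lambda>i. if i < Suc (Suc k) then subst_B G1 i else 0)
         (deriv_rest G1 (Suc k)) / to_fract (to_bivariate (mp_pderiv 1 G1))"

text \<open>The numerator is that of the fraction in lowest terms.\<close>
definition reduced_H :: "dpoly list \<Rightarrow> nat \<Rightarrow> complex poly poly" where
  "reduced_H C j =
     (if j = 1 then to_bivariate (hd C)
      else fst (quot_of_fract
        (mp_eval (\<lambda>c. to_fract [:[:c:]:]) (subst_B (hd C)) (C ! (j - 1)))))"

definition chain_reduced_ode :: "nat \<Rightarrow> dpoly list \<Rightarrow> complex poly poly" where
  "chain_reduced_ode m C = Gcd (reduced_H C ` {1..m})"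

definition reduced_ode :: "nat \<Rightarrow> dpoly list set \<Rightarrow> complex poly poly" where
  "reduced_ode m CS = Lcm (chain_reduced_ode m ` remaining_chains CS)"

datatype expansion_point = At complex | At_infinity

text \<open>
  A formal Puiseux series with ramification index \<open>n > 0\<close> is given by a Laurent series \<open>f\<close> whose
  coefficient \<open>fls_nth f j\<close> is the coefficient of \<open>(x - x\<^sub>0)\<^sup>j\<^sup>/\<^sup>n\<close>, and of \<open>x\<^sup>-\<^sup>j\<^sup>/\<^sup>n\<close> at infinity. The series \<open>x\<close>
  itself is \<open>x\<^sub>0 + t\<^sup>n\<close>, and \<open>t\<^sup>-\<^sup>n\<close> at infinity.
\<close>
fun puiseux_x :: "expansion_point \<Rightarrow> nat \<Rightarrow> complex fls" where
  "puiseux_x (At x0) n = fls_const x0 + fls_X ^ n"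
| "puiseux_x At_infinity n = fls_X_inv ^ n"

text \<open>
  Term-by-term derivation in \<open>x\<close>: \<open>t\<^sup>j\<close> is sent to \<open>(j/n) t\<^sup>j\<^sup>-\<^sup>n\<close>, and to \<open>-(j/n) t\<^sup>j\<^sup>+\<^sup>n\<close> at infinity.
\<close>
fun puiseux_deriv :: "expansion_point \<Rightarrow> nat \<Rightarrow> complex fls \<Rightarrow> complex fls" where
  "puiseux_deriv (At x0) n f = fls_const (1 / of_nat n) * fls_shift (int n - 1) (fls_deriv f)"
| "puiseux_deriv At_infinity n f =
     fls_const (- 1 / of_nat n) * fls_shift (- int n - 1) (fls_deriv f)"

definition puiseux_solution ::
  "expansion_point \<Rightarrow> nat \<Rightarrow> dpoly set \<Rightarrow> complex fls \<Rightarrow> bool" where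
  "puiseux_solution pt n S y \<longleftrightarrow>
     (\<forall>p\<in>S. mp_eval fls_const (\<lambda>i. (puiseux_deriv pt n ^^ i) y) p = 0)"

definition eval_x :: "expansion_point \<Rightarrow> nat \<Rightarrow> complex poly \<Rightarrow> complex fls" where
  "eval_x pt n q = poly (map_poly fls_const q) (puiseux_x pt n)"

definition eval_xY :: "expansion_point \<Rightarrow> nat \<Rightarrow> complex poly poly \<Rightarrow> complex fls \<Rightarrow> complex fls" where
  "eval_xY pt n P y = poly (map_poly (eval_x pt n) P) y"

definition algebraic_over_Cx :: "expansion_point \<Rightarrow> nat \<Rightarrow> complex fls \<Rightarrow> bool" where
  "algebraic_over_Cx pt n y \<longleftrightarrow> (\<exists>P. P \<noteq> 0 \<and> eval_xY pt n P y = 0)"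

definition is_minimal_polynomial ::
  "expansion_point \<Rightarrow> nat \<Rightarrow> complex fls \<Rightarrow> complex poly poly \<Rightarrow> bool" where
  "is_minimal_polynomial pt n y G \<longleftrightarrow> Factorial_Ring.irreducible G \<and> eval_xY pt n G y = 0"

definition represents_quotient ::
  "expansion_point \<Rightarrow> nat \<Rightarrow> complex fls \<Rightarrow> complex poly \<Rightarrow> complex poly \<Rightarrow> bool" where
  "represents_quotient pt n y p q \<longleftrightarrow>
     q \<noteq> 0 \<and> coprime p q \<and> y = eval_x pt n p / eval_x pt n q"

end

theory Submission
  imports Defs
begin

text \<open>
  Let \<open>y\<close> be a solution. It lies on one of the chains, and an irreducible factor \<open>F\<close> of its \<open>G\<^sub>1\<close> with
  \<open>F(y, y') = 0\<close> divides all the \<open>H\<^sub>j\<close>: the fractions \<open>B\<^sub>j\<close> take the value \<open>y\<^sup>(\<^sup>j\<^sup>)\<close> at \<open>(y, y')\<close>. Hence \<open>F\<close>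
  divides the reduced equation, and it suffices to bound the degrees of \<open>G\<close> by those of \<open>F\<close>.

  The field \<open>M = \<complex>(y, y')\<close> is closed under the derivation and \<open>x\<close> is algebraic over it, so \<open>x \<in> M\<close>.
  As \<open>M\<close> is spanned over \<open>\<complex>(y)\<close> by \<open>t = deg\<^sub>y\<^sub>' F\<close> elements, \<open>x\<close> has degree at most \<open>t\<close> over
  \<open>\<complex>(y)\<close>, which is the bound for the degree of \<open>G\<close> in \<open>x\<close>. In the same way there is a relation
  \<open>K(x, y') = 0\<close> whose degree in \<open>x\<close> is at most \<open>s = deg\<^sub>y F\<close>.

  For the degree of \<open>G\<close> in \<open>Y\<close>, take the \<open>d\<close> conjugates \<open>y\<^sub>i\<close> of \<open>y\<close> as Puiseux series in
  \<open>\<tau> = x\<^sup>-\<^sup>1\<^sup>/\<^sup>N\<close> at infinity. Their derivatives are distinct roots of \<open>K\<close>. By the Newton polygons of \<open>G\<close>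
  and \<open>K\<close> the \<open>y\<^sub>i\<close> have at most \<open>N t\<close> poles and the \<open>y\<^sub>i'\<close> at most \<open>N s\<close> zeros in \<open>\<tau>\<close>, counted with
  multiplicity, whereas each pair \<open>(y\<^sub>i, y\<^sub>i')\<close> contributes at least \<open>N\<close>. Therefore \<open>d \<le> s + t\<close>.
\<close>

no_notation vec_index (infixl "$" 100)

subsection \<open>Hensel's lemma and Newton--Puiseux\<close>

text \<open>Bezout gives \<open>u g + v h = 1\<close>; reducing \<open>v r\<close> modulo
  \<open>g\<close> keeps \<open>a\<close> small, and then \<open>g b = r - h a\<close> bounds the
  degree of \<open>b\<close>. This is the equation to be solved at each order of Hensel
  lifting.\<close>

lemma coprime_linear_combination:
  fixes g h r :: "complex poly"
  assumes "coprime g h" "degree g > 0" "degree h > 0" "degree r < degree g + degree h"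
  shows "\<exists>a b. g * b + h * a = r \<and> degree a < degree g \<and> degree b < degree h"
proof -
  obtain u v where uv: "u * g + v * h = 1"
    using assms(1) by (metis bezout_coefficients_fst_snd coprime_imp_gcd_eq_1)
  define a where "a = (v * r) mod g"
  have da: "degree a < degree g"
    unfolding a_def by (metis assms(2) degree_0 degree_mod_less less_irrefl)
  have "g dvd r - h * a"
  proof -
    have "g dvd v * r - a"
      unfolding a_def by (simp add: minus_mod_eq_mult_div)
    hence "g dvd h * (v * r - a)" by (rule dvd_mult)
    moreover have "r = (u * g + v * h) * r" using uv by simp
    hence "r - h * a = h * (v * r - a) + g * (u * r)"
      by (simp add: algebra_simps)
    ultimately show ?thesis by simp
  qed
  then obtain b where b: "r - h * a = g * b" by auto
  have "degree b < degree h"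
  proof (cases "b = 0")
    case False
    have "degree (h * a) < degree g + degree h"
      using da by (metis add.commute add_strict_left_mono degree_mult_le le_less_trans)
    hence "degree (g * b) < degree g + degree h"
      using assms(4) unfolding b[symmetric] by (rule degree_diff_less[rotated])
    moreover have "degree (g * b) = degree g + degree b"
      using False assms(2) by (intro degree_mult_eq) auto
    ultimately show ?thesis by simp
  qed (use assms in auto)
  thus ?thesis using da b by (intro exI[of _ a] exI[of _ b]) (auto simp: algebra_simps)
qed

text \<open>The pair at \<open>n\<close> holds the coefficients of order \<open>n\<close> of the two
  factors: \<open>z\<close> is the pair at order 0, and \<open>s\<close> solves for the next pair
  once the products of earlier coefficients are subtracted from \<open>p n\<close>.\<close>

function hensel_seq ::
  "('a::comm_ring_1 \<times> 'a) \<Rightarrow> ('a \<Rightarrow> 'a \<times> 'a) \<Rightarrow> (nat \<Rightarrow> 'a) \<Rightarrow> nat \<Rightarrow> 'a \<times> 'a" where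
  "hensel_seq z s p n = (if n = 0 then z else
     s (p n - (\<Sum>k\<in>{1..<n}. fst (hensel_seq z s p k) * snd (hensel_seq z s p (n - k)))))"
  by auto
termination by (relation "measure (\<lambda>(_,_,_,n). n)") auto

declare hensel_seq.simps [simp del]

text \<open>At order \<open>n\<close> the product reads \<open>g0 h_n + h0 g_n = P_n\<close> minus
  products of lower coefficients. The degree bound on \<open>P $ n\<close> makes this solvable with
  small \<open>g_n\<close> and \<open>h_n\<close>, which keeps the next right-hand side small as
  well.\<close>

lemma hensel_fps:
  fixes P :: "complex poly fps" and g0 h0 :: "complex poly"
  assumes "coprime g0 h0" "degree g0 > 0" "degree h0 > 0" "P $ 0 = g0 * h0"
    and "\<And>n. n > 0 \<Longrightarrow> degree (P $ n) < degree g0 + degree h0"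
  shows "\<exists>g h. P = g * h \<and> g $ 0 = g0 \<and> h $ 0 = h0 \<and>
     (\<forall>n>0. degree (g $ n) < degree g0) \<and> (\<forall>n>0. degree (h $ n) < degree h0)"
proof -
  define s where "s = (\<lambda>r. SOME ab. g0 * snd ab + h0 * fst ab = r \<and>
     degree (fst ab) < degree g0 \<and> degree (snd ab) < degree h0)"
  have s: "g0 * snd (s r) + h0 * fst (s r) = r \<and> degree (fst (s r)) < degree g0 \<and>
      degree (snd (s r)) < degree h0" if "degree r < degree g0 + degree h0" for r
    unfolding s_def
    by (rule someI_ex) (use coprime_linear_combination[OF assms(1-3) that] in auto)
  define q where "q = hensel_seq (g0, h0) s (fps_nth P)"
  define R where "R n = P $ n - (\<Sum>k\<in>{1..<n}. fst (q k) * snd (q (n - k)))" for n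
  have q0: "q 0 = (g0, h0)" by (simp add: q_def hensel_seq.simps)
  have qn: "q n = s (R n)" if "n > 0" for n
    using that unfolding q_def R_def by (subst hensel_seq.simps) simp
  have deg: "degree (R n) < degree g0 + degree h0 \<and> degree (fst (q n)) < degree g0 \<and>
      degree (snd (q n)) < degree h0" if "n > 0" for n
    using that
  proof (induction n rule: less_induct)
    case (less n)
    have "degree (\<Sum>k\<in>{1..<n}. fst (q k) * snd (q (n - k))) < degree g0 + degree h0"
    proof (rule degree_sum_less)
      fix k assume k: "k \<in> {1..<n}"
      have "degree (fst (q k)) < degree g0" "degree (snd (q (n - k))) < degree h0"
        using less.IH[of k] less.IH[of "n - k"] k by auto
      thus "degree (fst (q k) * snd (q (n - k))) < degree g0 + degree h0"
        by (meson add_strict_mono degree_mult_le le_less_trans)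
    qed (use assms in auto)
    hence "degree (R n) < degree g0 + degree h0"
      unfolding R_def using assms(5)[OF less.prems] by (intro degree_diff_less) auto
    with s[OF this] qn[OF less.prems] show ?case by simp
  qed
  define g where "g = Abs_fps (\<lambda>n. fst (q n))"
  define h where "h = Abs_fps (\<lambda>n. snd (q n))"
  have "P = g * h"
  proof (rule fps_ext)
    fix n show "P $ n = (g * h) $ n"
    proof (cases "n = 0")
      case True thus ?thesis using assms(4) by (simp add: g_def h_def q0)
    next
      case False
      have eq: "{0..n} = insert 0 (insert n {1..<n})" using False by auto
      have "(g * h) $ n = (\<Sum>k\<in>{1..<n}. fst (q k) * snd (q (n - k))) + (g0 * snd (q n) + h0 * fst (q n))"
        using False by (simp add: fps_mult_nth g_def h_def eq q0 algebra_simps)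
      also have "g0 * snd (q n) + h0 * fst (q n) = R n"
        using s[of "R n"] deg[of n] qn[of n] False by simp
      finally show ?thesis by (simp add: R_def)
    qed
  qed
  thus ?thesis using deg
    by (intro exI[of _ g] exI[of _ h]) (auto simp: g_def h_def q0)
qed

text \<open>Meant for the shift \<open>b = - coeff P k / (k + 1)\<close>, which removes the second
  coefficient. Only the two top terms of \<open>P\<close> reach index \<open>k\<close>; the
  remainder \<open>R\<close> contributes nothing there.\<close>

lemma monic_coeff_pcompose_shift:
  fixes P :: "'a::field_char_0 poly"
  assumes "lead_coeff P = 1" "degree P = Suc k"
  shows "coeff (pcompose P [:b, 1:]) k = coeff P k + of_nat (Suc k) * b"
proof -
  define R where "R = P - monom 1 (Suc k) - monom (coeff P k) k"
  have R: "coeff R i = 0" if "i \<ge> k" for i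
    using assms that by (cases "i = k"; cases "i = Suc k") (auto simp: R_def coeff_eq_0)
  have dR: "coeff (pcompose R [:b, 1:]) k = 0"
  proof (cases "R = 0")
    case False
    hence "degree R < k" using R by (meson leading_coeff_neq_0 not_le)
    thus ?thesis by (intro coeff_eq_0) (simp add: degree_pcompose)
  qed simp
  have P: "P = monom 1 (Suc k) + monom (coeff P k) k + R" by (simp add: R_def)
  have m: "pcompose (monom c n) [:b, 1:] = smult c ([:b, 1:] ^ n)" for c :: 'a and n
    by (induction n) (simp_all add: monom_0 monom_Suc pcompose_pCons)
  have "coeff (pcompose P [:b, 1:]) k =
      coeff ([:b, 1:] ^ Suc k) k + coeff P k * coeff ([:b, 1:] ^ k) k + 0"
    by (subst P, unfold pcompose_add m coeff_add dR) simp
  thus ?thesis by (simp add: coeff_linear_poly_power del: power_Suc)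
qed

text \<open>Split off a root \<open>a\<close> with its full multiplicity. A constant cofactor would
  make \<open>p\<close> the power \<open>(Y - a)^(k+1)\<close>, whose coefficient
  \<open>- (k + 1) a\<close> of index \<open>k\<close> vanishes only for \<open>a = 0\<close>, and
  that case is excluded.\<close>

lemma monic_complex_poly_coprime_factorization:
  fixes p :: "complex poly"
  assumes "lead_coeff p = 1" "degree p = Suc k" "coeff p k = 0" "p \<noteq> monom 1 (Suc k)"
  shows "\<exists>g h. p = g * h \<and> coprime g h \<and> degree g > 0 \<and> degree h > 0"
proof -
  obtain a where a: "poly p a = 0"
    using assms(2) by (metis fundamental_theorem_of_algebra constant_degree Zero_neq_Suc)
  have p0: "p \<noteq> 0" using assms by auto
  define n where "n = order a p"
  have n: "n > 0" unfolding n_def using a p0 by (simp add: order_root)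
  obtain h where h: "p = [:-a, 1:] ^ n * h" "\<not> [:-a, 1:] dvd h"
    using order_decomp[OF p0, of a] unfolding n_def by blast
  have h0: "h \<noteq> 0" using p0 h by auto
  have "degree h > 0"
  proof (rule ccontr)
    assume "\<not> degree h > 0"
    then obtain c where c: "h = [:c:]" by (meson degree_eq_zeroE neq0_conv)
    have "lead_coeff p = lead_coeff ([:-a, 1:] ^ n) * c"
      using h(1) c by (simp add: lead_coeff_mult)
    hence "c = 1" using assms(1) by (simp add: lead_coeff_power)
    hence p: "p = [:-a, 1:] ^ n" using h c by simp
    hence "n = Suc k" using assms(2) by (simp add: degree_linear_power)
    hence "coeff p k = of_nat (Suc k) * (- a)" using p by (simp add: coeff_linear_poly_power del: power_Suc)
    hence "a = 0" using assms(3) by (simp del: of_nat_Suc)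
    thus False using p assms(4) \<open>n = Suc k\<close> by (simp add: monom_altdef)
  qed
  moreover have "coprime ([:-a, 1:] ^ n) h"
    using h(2) by (intro coprime_power_left_iff[THEN iffD2] disjI1 prime_elem_imp_coprime
        prime_elem_linear_field_poly) auto
  ultimately show ?thesis using h(1) n
    by (intro exI[of _ "[:-a, 1:] ^ n"] exI[of _ h]) (auto simp: degree_linear_power)
qed

lemma fps_to_fls_sum: "fps_to_fls (\<Sum>i\<in>A. f i) = (\<Sum>i\<in>A. fps_to_fls (f i))"
  by (induction A rule: infinite_finite_induct) auto

text \<open>A polynomial in \<open>Y\<close> over power series in \<open>t\<close> is read as a
  power series in \<open>t\<close> over polynomials in \<open>Y\<close>, factored by
  \<open>hensel_fps\<close>, and read back.\<close>

lemma hensel_fls_poly: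
  fixes P :: "complex fls poly"
  assumes int: "\<And>i m. m < 0 \<Longrightarrow> fls_nth (coeff P i) m = 0"
    and monic: "lead_coeff P = 1"
    and red: "map_poly (\<lambda>c. fls_nth c 0) P = g0 * h0"
    and cop: "coprime g0 h0" "degree g0 > 0" "degree h0 > 0"
  shows "\<exists>G H. P = G * H \<and> degree G = degree g0"
proof -
  define Q where "Q = Abs_fps (\<lambda>n. map_poly (\<lambda>c. fls_nth c (int n)) P)"
  have Q: "coeff (Q $ n) i = fls_nth (coeff P i) (int n)" for n i
    by (simp add: Q_def coeff_map_poly)
  have Q0: "Q $ 0 = g0 * h0" using red by (simp add: Q_def)
  have "coeff (Q $ 0) (degree P) = 1" using monic by (simp add: Q)
  hence "degree (Q $ 0) = degree P"
    by (metis Q_def antisym degree_map_poly_le fps_nth_Abs_fps le_degree zero_neq_one)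
  moreover have nz: "g0 \<noteq> 0" "h0 \<noteq> 0" using cop by auto
  ultimately have d: "degree P = degree g0 + degree h0"
    using Q0 by (simp add: degree_mult_eq)
  \<comment> \<open>\<open>P\<close> is monic, and its leading coefficient 1 contributes to order 0
    only.\<close>
  have "degree (Q $ n) < degree P" if "n > 0" for n
  proof (rule ccontr)
    assume *: "\<not> degree (Q $ n) < degree P"
    have "degree (Q $ n) \<le> degree P" by (simp add: Q_def degree_map_poly_le)
    with * have e: "degree (Q $ n) = degree P" by simp
    hence "lead_coeff (Q $ n) = 0" using monic that by (simp add: Q)
    hence "Q $ n = 0" by simp
    with e d cop show False by simp
  qed
  then obtain g h where gh: "Q = g * h" "g $ 0 = g0" "h $ 0 = h0"
    "\<And>n. n > 0 \<Longrightarrow> degree (g $ n) < degree g0" "\<And>n. n > 0 \<Longrightarrow> degree (h $ n) < degree h0"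
    using hensel_fps[OF cop Q0] d by metis
  \<comment> \<open>\<open>T\<close> leads back from series of polynomials to polynomials over
    series.\<close>
  define T where "T = (\<lambda>(f :: complex poly fps) d. \<Sum>i\<le>d. monom (fps_to_fls (Abs_fps (\<lambda>n. coeff (f $ n) i))) i)"
  have T: "coeff (T f d) i = fps_to_fls (Abs_fps (\<lambda>n. coeff (f $ n) i))"
    if "\<And>n. degree (f $ n) \<le> d" for f :: "complex poly fps" and d i
  proof -
    have "coeff (T f d) i = (if i \<le> d then fps_to_fls (Abs_fps (\<lambda>n. coeff (f $ n) i)) else 0)"
      by (simp add: T_def coeff_sum)
    also have "\<dots> = fps_to_fls (Abs_fps (\<lambda>n. coeff (f $ n) i))"
    proof (cases "i \<le> d")
      case False
      hence "coeff (f $ n) i = 0" for n using that[of n] by (intro coeff_eq_0) auto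
      hence "Abs_fps (\<lambda>n. coeff (f $ n) i) = 0" by (simp add: fps_eq_iff)
      thus ?thesis using False by simp
    qed simp
    finally show ?thesis .
  qed
  have dg: "degree (g $ n) \<le> degree g0" and dh: "degree (h $ n) \<le> degree h0" for n
    using gh(2,3) gh(4,5)[of n] by (cases "n = 0"; simp)+
  have "P = T g (degree g0) * T h (degree h0)"
  proof (rule poly_eqI)
    fix i
    have 1: "coeff P i = fps_to_fls (Abs_fps (\<lambda>n. coeff (Q $ n) i))"
    proof (rule fls_eqI)
      fix m show "fls_nth (coeff P i) m = fls_nth (fps_to_fls (Abs_fps (\<lambda>n. coeff (Q $ n) i))) m"
        by (cases "m < 0") (auto simp: int Q)
    qed
    have "Abs_fps (\<lambda>n. coeff (Q $ n) i) =
        (\<Sum>j\<le>i. Abs_fps (\<lambda>n. coeff (g $ n) j) * Abs_fps (\<lambda>n. coeff (h $ n) (i - j)))"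
      unfolding gh(1) by (rule fps_ext)
        (simp add: fps_mult_nth coeff_sum coeff_mult fps_sum_nth sum.swap[of _ "{..i}"])
    thus "coeff P i = coeff (T g (degree g0) * T h (degree h0)) i"
      unfolding 1 coeff_mult T[OF dg] T[OF dh] fls_times_fps_to_fls[symmetric]
      by (simp add: fps_to_fls_sum)
  qed
  moreover have "degree (T g (degree g0)) = degree g0"
  proof (rule antisym)
    show "degree (T g (degree g0)) \<le> degree g0"
      unfolding T_def by (intro degree_sum_le) (auto intro: order.trans[OF degree_monom_le])
    have "fls_nth (coeff (T g (degree g0)) (degree g0)) 0 = lead_coeff g0"
      by (simp add: T[OF dg] gh)
    hence "coeff (T g (degree g0)) (degree g0) \<noteq> 0" using nz by auto
    thus "degree g0 \<le> degree (T g (degree g0))" by (rule le_degree)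
  qed
  ultimately show ?thesis by blast
qed

section \<open>Ramification: replacing the series variable \<open>t\<close> by \<open>t^N\<close>,
  and Puiseux series roots\<close>

context
  fixes N :: nat assumes N: "N > 0"
begin

interpretation ram: inj_idom_hom "\<lambda>c :: 'a::idom fls. fls_compose_power c N"
proof
  fix x :: "'a fls" assume "fls_compose_power x N = 0"
  hence "fls_nth (fls_compose_power x N) (int N * m) = 0" for m by simp
  thus "x = 0" using N by (auto simp: fls_nth_compose_power fls_eq_iff)
qed (use N in auto)

lemmas inj_idom_hom_fls_compose_power = ram.inj_idom_hom_axioms

end

lemma fls_compose_power_compose_power:
  "N > 0 \<Longrightarrow> M > 0 \<Longrightarrow> fls_compose_power (fls_compose_power f M) N = fls_compose_power f (M * N)"
  by (rule fls_eqI) (auto simp: fls_nth_compose_power div_mult2_eq mult.commute dvd_def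
      zdiv_zmult2_eq)

text \<open>This is a root in Laurent series of \<open>t^(1/N)\<close>, made an ordinary Laurent
  series by replacing \<open>t\<close> by \<open>t^N\<close>.\<close>

definition ramified_root :: "'a::idom fls poly \<Rightarrow> bool" where
  "ramified_root P \<longleftrightarrow> (\<exists>N>0. \<exists>y. poly (map_poly (\<lambda>c. fls_compose_power c N) P) y = 0)"

lemma ramified_root_mult:
  assumes "ramified_root P" shows "ramified_root (P * Q :: 'a::idom fls poly)"
proof -
  obtain N y where N: "N > 0" "poly (map_poly (\<lambda>c. fls_compose_power c N) P) y = 0"
    using assms by (auto simp: ramified_root_def)
  interpret inj_idom_hom "\<lambda>c :: 'a fls. fls_compose_power c N"
    by (rule inj_idom_hom_fls_compose_power) fact
  interpret p: map_poly_inj_idom_hom "\<lambda>c :: 'a fls. fls_compose_power c N" ..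
  show ?thesis using N unfolding ramified_root_def
    by (intro exI[of _ N] conjI exI[of _ y]) (auto simp: p.hom_mult)
qed

lemma ramified_root_smult:
  assumes "ramified_root (smult c P)" "c \<noteq> 0" shows "ramified_root (P :: 'a::idom fls poly)"
proof -
  obtain N y where N: "N > 0" "poly (map_poly (\<lambda>c. fls_compose_power c N) (smult c P)) y = 0"
    using assms by (auto simp: ramified_root_def)
  interpret inj_idom_hom "\<lambda>c :: 'a fls. fls_compose_power c N"
    by (rule inj_idom_hom_fls_compose_power) fact
  show ?thesis using N assms(2) unfolding ramified_root_def
    by (intro exI[of _ N] conjI exI[of _ y]) (auto simp: map_poly_hom_smult)
qed

lemma ramified_root_pcompose:
  assumes "ramified_root (pcompose P Q)" shows "ramified_root (P :: 'a::idom fls poly)"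
proof -
  obtain N y where N: "N > 0" "poly (map_poly (\<lambda>c. fls_compose_power c N) (pcompose P Q)) y = 0"
    using assms by (auto simp: ramified_root_def)
  interpret inj_idom_hom "\<lambda>c :: 'a fls. fls_compose_power c N"
    by (rule inj_idom_hom_fls_compose_power) fact
  show ?thesis using N unfolding ramified_root_def
    by (intro exI[of _ N] conjI exI) (auto simp: map_poly_pcompose poly_pcompose)
qed

lemma ramified_root_compose_power:
  assumes "ramified_root (map_poly (\<lambda>c. fls_compose_power c M) P)" "M > 0"
  shows "ramified_root (P :: 'a::idom fls poly)"
proof -
  obtain N y where N: "N > 0" "poly (map_poly (\<lambda>c. fls_compose_power c N)
      (map_poly (\<lambda>c. fls_compose_power c M) P)) y = 0"
    using assms by (auto simp: ramified_root_def)
  have "map_poly (\<lambda>c. fls_compose_power c N) (map_poly (\<lambda>c. fls_compose_power c M) P) =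
      map_poly (\<lambda>c. fls_compose_power c (M * N)) P"
    using N assms(2) by (subst map_poly_map_poly) (auto simp: o_def fls_compose_power_compose_power)
  thus ?thesis using N assms(2) unfolding ramified_root_def
    by (intro exI[of _ "M * N"] conjI exI[of _ y]) auto
qed

lemma int_div_less:
  fixes a b c :: int
  assumes "a < c * b" "b > 0" shows "a div b < c"
proof -
  have "(a div b) * b \<le> a" using assms(2) by (simp add: minus_mod_eq_div_mult[symmetric])
  thus ?thesis using assms by (meson le_less_trans mult_less_cancel_right_pos)
qed

text \<open>Ramifying and scaling by the steepest slope of the Newton polygon makes \<open>P\<close> integral with a
  reduction other than \<open>Y\<^sup>k\<^sup>+\<^sup>1\<close>. As the second coefficient vanishes, the reduction is then not a
  power of a linear polynomial, and Hensel's lemma applies.\<close>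
lemma newton_polygon_normalization:
  fixes P :: "complex fls poly"
  assumes monic: "lead_coeff P = 1" and deg: "degree P = Suc k" and "coeff P k = 0"
    and "P \<noteq> monom 1 (Suc k)"
  shows "\<exists>M q c. M > 0 \<and> c \<noteq> 0 \<and>
    (let R = smult c (pcompose (map_poly (\<lambda>c. fls_compose_power c M) P) [:0, fls_X_intpow q:])
     in lead_coeff R = 1 \<and> degree R = Suc k \<and> coeff R k = 0 \<and>
        (\<forall>i m. m < 0 \<longrightarrow> fls_nth (coeff R i) m = 0) \<and> (\<exists>j\<le>k. fls_nth (coeff R j) 0 \<noteq> 0))"
proof -
  define d where "d = Suc k"
  define J where "J = {j. j < d \<and> coeff P j \<noteq> 0}"
  have fin: "finite J" by (simp add: J_def)
  have "J \<noteq> {}"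
  proof
    assume "J = {}"
    hence "coeff P i = coeff (monom 1 d) i" for i
      using monic deg by (cases "i = d"; cases "i < d") (auto simp: J_def d_def coeff_eq_0)
    thus False using assms(4) by (auto simp: poly_eq_iff d_def)
  qed
  \<comment> \<open>Every \<open>d - j\<close> with \<open>j < d\<close> divides \<open>M\<close>,
    so ramification by \<open>M\<close> makes all slopes \<open>v j\<close> integers.\<close>
  define M where "M = (fact d :: nat)"
  define v where "v j = int (M div (d - j)) * fls_subdegree (coeff P j)" for j
  define q where "q = Min (v ` J)"
  have q: "q \<le> v j" if "j \<in> J" for j using fin that by (simp add: q_def)
  obtain j0 where j0: "j0 \<in> J" "v j0 = q"
    using Min_in[of "v ` J"] fin \<open>J \<noteq> {}\<close> unfolding q_def by fastforce
  have M: "M > 0" by (simp add: M_def)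
  have v: "int M * fls_subdegree (coeff P j) = int (d - j) * v j" if "j < d" for j
  proof -
    have "d - j dvd M" unfolding M_def using that by (intro dvd_fact) auto
    hence "int M = int (d - j) * int (M div (d - j))" by (metis dvd_mult_div_cancel of_nat_mult)
    thus ?thesis by (simp add: v_def)
  qed
  \<comment> \<open>For \<open>i\<close> in \<open>J\<close> the coefficient of index
    \<open>i\<close> gets the order \<open>(d - i) * (v i - q)\<close>, which is nonnegative, and
    zero at \<open>j0\<close>; the leading coefficient stays 1.\<close>
  define R where "R = smult (fls_X_intpow (- (int d * q)))
     (pcompose (map_poly (\<lambda>c. fls_compose_power c M) P) [:0, fls_X_intpow q:])"
  have R: "coeff R i = fls_shift (int d * q - int i * q) (fls_compose_power (coeff P i) M)" for i
    by (simp add: R_def coeff_pcompose_linear coeff_map_poly fls_X_intpow_power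
        fls_shifted_times_simps algebra_simps)
  have nth: "fls_nth (coeff R i) m =
      (if int M dvd m + int (d - i) * q then fls_nth (coeff P i) ((m + int (d - i) * q) div int M) else 0)"
    if "i \<le> d" for i m
    using M that by (simp add: R fls_nth_compose_power algebra_simps of_nat_diff)
  have Rd: "coeff R d = 1" using monic deg M by (simp add: R d_def)
  have "coeff R i = 0" if "i > d" for i
    using that deg by (simp add: R d_def coeff_eq_0)
  hence dR: "degree R = d"
    using Rd by (intro antisym degree_le le_degree) auto
  have int: "fls_nth (coeff R i) m = 0" if "m < 0" for i m
  proof -
    consider "i > d" | "i = d" | "i < d" "i \<notin> J" | "i \<in> J" by linarith
    thus ?thesis
    proof cases
      case 1 thus ?thesis using dR by (simp add: coeff_eq_0)
    next
      case 2 thus ?thesis using Rd that by simp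
    next
      case 3 thus ?thesis by (simp add: R J_def)
    next
      case 4
      hence i: "i < d" "coeff P i \<noteq> 0" by (auto simp: J_def)
      have "m + int (d - i) * q < int (d - i) * v i"
        using that q[OF 4] mult_left_mono[of q "v i" "int (d - i)"] by linarith
      hence "m + int (d - i) * q < int M * fls_subdegree (coeff P i)" using v[OF i(1)] by simp
      hence "(m + int (d - i) * q) div int M < fls_subdegree (coeff P i)"
        using M by (intro int_div_less) (simp_all add: mult.commute)
      thus ?thesis using i by (simp add: nth)
    qed
  qed
  have "fls_nth (coeff R j0) 0 \<noteq> 0"
  proof -
    have j: "j0 < d" "coeff P j0 \<noteq> 0" using j0 by (auto simp: J_def)
    have "int (d - j0) * q = int M * fls_subdegree (coeff P j0)" using v[OF j(1)] j0 by simp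
    thus ?thesis using j M by (simp add: nth)
  qed
  moreover have "j0 \<le> k" using j0 by (auto simp: J_def d_def)
  moreover have "coeff R k = 0" by (simp add: R assms(3))
  ultimately show ?thesis using M dR Rd int
    by (intro exI[of _ M] exI[of _ q] exI[of _ "fls_X_intpow (- (int d * q))"])
       (unfold Let_def R_def[symmetric], auto simp: d_def fls_shift_eq0_iff)
qed

text \<open>Make \<open>P\<close> monic and shift the second coefficient away. Unless a power of
  \<open>Y\<close> is left, the Newton polygon normalization and Hensel's lemma give a factor of
  smaller positive degree, to which the induction applies; the transformations are then
  undone.\<close>

lemma ramified_root_exists:
  fixes P :: "complex fls poly"
  assumes "degree P > 0" shows "ramified_root P"
  using assms
proof (induction "degree P" arbitrary: P rule: less_induct)
  case less
  obtain k where k: "degree P = Suc k" using less.prems gr0_conv_Suc by blast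
  define P0 where "P0 = smult (inverse (lead_coeff P)) P"
  have nz: "lead_coeff P \<noteq> 0" using less.prems by auto
  have P0: "lead_coeff P0 = 1" "degree P0 = Suc k" using nz k by (auto simp: P0_def)
  define b where "b = - coeff P0 k / of_nat (Suc k)"
  define P1 where "P1 = pcompose P0 [:b, 1:]"
  have P1: "degree P1 = Suc k" "lead_coeff P1 = 1" "coeff P1 k = 0"
    using P0 monic_coeff_pcompose_shift[OF P0, of b]
      lead_coeff_comp[of "[:b, 1:]" P0]
    unfolding P1_def by (simp_all only: degree_pcompose) (simp_all add: b_def del: of_nat_Suc)
  have "ramified_root P1"
  proof (cases "P1 = monom 1 (Suc k)")
    case True
    show ?thesis unfolding ramified_root_def True
      by (intro exI[of _ 1] exI[of _ 0] conjI) (auto simp: map_poly_monom poly_monom)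
  next
    case False
    obtain M q c R where R: "M > 0" "c \<noteq> 0"
      "R = smult c (pcompose (map_poly (\<lambda>c. fls_compose_power c M) P1) [:0, fls_X_intpow q:])"
      "lead_coeff R = 1" "degree R = Suc k" "coeff R k = 0"
      "\<And>i m. m < 0 \<Longrightarrow> fls_nth (coeff R i) m = 0" "\<exists>j\<le>k. fls_nth (coeff R j) 0 \<noteq> 0"
      using newton_polygon_normalization[OF P1(2,1,3) False] unfolding Let_def by metis
    define p where "p = map_poly (\<lambda>c. fls_nth c 0) R"
    have p: "coeff p i = fls_nth (coeff R i) 0" for i by (simp add: p_def coeff_map_poly)
    have "degree p = Suc k"
      using R(4,5) by (metis p p_def antisym degree_map_poly_le le_degree fls_one_nth zero_neq_one)
    moreover from this have "lead_coeff p = 1" "coeff p k = 0" using R(4-6) by (auto simp: p)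
    moreover have "p \<noteq> monom 1 (Suc k)" using R(8) by (auto simp: p[symmetric])
    ultimately obtain g h where gh: "p = g * h" "coprime g h" "degree g > 0" "degree h > 0"
      using monic_complex_poly_coprime_factorization by blast
    hence "degree g < degree P" using \<open>degree p = Suc k\<close> k
      by (metis degree_0 degree_mult_eq less_add_same_cancel1 less_numeral_extra(3))
    moreover obtain G H where GH: "R = G * H" "degree G = degree g"
      using hensel_fls_poly[OF R(7,4) gh(1)[unfolded p_def] gh(2-4)] by blast
    ultimately have "ramified_root G" using less.hyps[of G] gh by simp
    hence "ramified_root R" unfolding GH by (rule ramified_root_mult)
    thus ?thesis unfolding R(3)
      using R(1,2) by (blast intro: ramified_root_smult ramified_root_pcompose ramified_root_compose_power)
  qed
  thus ?case unfolding P1_def P0_def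
    using nz by (auto dest!: ramified_root_pcompose intro: ramified_root_smult simp: P0_def)
qed

text \<open>One root is split off at a time. The cofactor may need a further ramification, so the
  indices multiply and the root already found is substituted along.\<close>

theorem newton_puiseux:
  fixes P :: "complex fls poly"
  assumes "P \<noteq> 0"
  shows "\<exists>N>0. \<exists>ys. length ys = degree P \<and> map_poly (\<lambda>c. fls_compose_power c N) P =
     smult (fls_compose_power (lead_coeff P) N) (\<Prod>y\<leftarrow>ys. [:-y, 1:])"
  using assms
proof (induction "degree P" arbitrary: P)
  case 0
  then obtain c where "P = [:c:]" by (metis degree_eq_zeroE)
  thus ?case by (intro exI[of _ 1] conjI exI[of _ "[]"]) (auto intro!: poly_eqI simp: coeff_map_poly coeff_pCons split: nat.split)
next
  case (Suc d)
  obtain N y where N: "N > 0" "poly (map_poly (\<lambda>c. fls_compose_power c N) P) y = 0"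
    using ramified_root_exists[of P] Suc by (auto simp: ramified_root_def)
  interpret N: inj_idom_hom "\<lambda>c :: complex fls. fls_compose_power c N"
    by (rule inj_idom_hom_fls_compose_power) fact
  interpret Np: map_poly_inj_idom_hom "\<lambda>c :: complex fls. fls_compose_power c N" ..
  obtain Q where Q: "map_poly (\<lambda>c. fls_compose_power c N) P = [:-y, 1:] * Q"
    using N by (auto simp: poly_eq_0_iff_dvd elim: dvdE)
  have Q0: "Q \<noteq> 0" using Q Suc.prems by (metis Np.hom_0_iff mult_zero_right)
  have "degree ([:-y, 1:] * Q) = Suc d" using Q Suc.hyps(2) by (metis N.degree_map_poly_hom)
  hence dQ: "d = degree Q" using Q0 by (subst (asm) degree_mult_eq) auto
  have "lead_coeff ([:-y, 1:] * Q) = fls_compose_power (lead_coeff P) N"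
    unfolding Q[symmetric] using N(1) by (simp add: coeff_map_poly)
  hence lQ: "lead_coeff Q = fls_compose_power (lead_coeff P) N"
    unfolding lead_coeff_mult by simp
  obtain M ys where M: "M > 0" "length ys = degree Q" "map_poly (\<lambda>c. fls_compose_power c M) Q =
     smult (fls_compose_power (lead_coeff Q) M) (\<Prod>y\<leftarrow>ys. [:-y, 1:])"
    using Suc.hyps(1)[OF dQ Q0] by blast
  interpret M: inj_idom_hom "\<lambda>c :: complex fls. fls_compose_power c M"
    by (rule inj_idom_hom_fls_compose_power) fact
  interpret Mp: map_poly_inj_idom_hom "\<lambda>c :: complex fls. fls_compose_power c M" ..
  have "map_poly (\<lambda>c. fls_compose_power c (N * M)) P =
      map_poly (\<lambda>c. fls_compose_power c M) (map_poly (\<lambda>c. fls_compose_power c N) P)"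
    using M N by (subst map_poly_map_poly) (auto simp: o_def fls_compose_power_compose_power)
  also have "\<dots> = [:- fls_compose_power y M, 1:] * map_poly (\<lambda>c. fls_compose_power c M) Q"
    unfolding Q Mp.hom_mult using M(1) by simp
  also have "\<dots> = smult (fls_compose_power (lead_coeff P) (N * M))
      (\<Prod>y\<leftarrow>fls_compose_power y M # ys. [:-y, 1:])"
    unfolding M(3) lQ using M(1) N(1) by (simp add: fls_compose_power_compose_power)
  finally show ?case using M N dQ Suc.hyps(2)
    by (intro exI[of _ "N * M"] conjI exI[of _ "fls_compose_power y M # ys"]) auto
qed

subsection \<open>Orders of the roots of a polynomial\<close>

text \<open>The case \<open>f = 0\<close> is separate because \<open>fls_subdegree 0\<close> is 0,
  although the order of 0 is infinite.\<close>

abbreviation ord_ge :: "int \<Rightarrow> 'a::zero fls \<Rightarrow> bool" where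
  "ord_ge m f \<equiv> f = 0 \<or> m \<le> fls_subdegree f"

lemma ord_ge_add: "ord_ge m f \<Longrightarrow> ord_ge m g \<Longrightarrow> ord_ge m (f + g :: 'a::comm_ring_1 fls)"
  by (metis add.left_neutral add.right_neutral fls_plus_subdegree min.boundedI order.trans)

lemma ord_ge_uminus: "ord_ge m f \<Longrightarrow> ord_ge m (- f :: 'a::comm_ring_1 fls)"
  by simp

lemma ord_ge_sum: "(\<And>i. i \<in> A \<Longrightarrow> ord_ge m (f i)) \<Longrightarrow> ord_ge m (\<Sum>i\<in>A. f i :: 'a::comm_ring_1 fls)"
  by (induction A rule: infinite_finite_induct) (simp_all add: ord_ge_add)

lemma ord_ge_mult: "ord_ge m f \<Longrightarrow> ord_ge n g \<Longrightarrow> ord_ge (m + n) (f * g :: 'a::idom fls)"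
  by (cases "f = 0"; cases "g = 0") auto

text \<open>The coefficients of \<open>Q\<close> are recovered from those of
  \<open>(Y - y) Q\<close>: from the top down if \<open>y\<close> has no pole, which loses nothing,
  and from the bottom up, dividing by \<open>y\<close>, if it has one, which gains the order of the
  pole.\<close>

lemma ord_ge_coeff_linear_factor:
  fixes Q :: "'a::field fls poly"
  assumes "\<And>i. ord_ge (- B) (coeff ([:-y, 1:] * Q) i)"
  shows "ord_ge (- (B - max 0 (- fls_subdegree y))) (coeff Q i)"
proof (cases "fls_subdegree y < 0")
  case False
  define k where "k = Suc (degree Q) - i"
  have "ord_ge (- B) (coeff Q i)" if "k = Suc (degree Q) - i"
    using that
  proof (induction k arbitrary: i)
    case 0
    thus ?case by (simp add: coeff_eq_0)
  next
    case (Suc k)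
    have "coeff ([:-y, 1:] * Q) (Suc i) = coeff Q i - y * coeff Q (Suc i)" by simp
    hence "coeff Q i = coeff ([:-y, 1:] * Q) (Suc i) + y * coeff Q (Suc i)"
      by (simp only:) simp
    moreover have "ord_ge (- B) (coeff Q (Suc i))" using Suc by simp
    hence "ord_ge (- B) (y * coeff Q (Suc i))"
      using ord_ge_mult[of y 0 "coeff Q (Suc i)" "- B"] False by simp
    ultimately show ?case using assms ord_ge_add by metis
  qed
  thus ?thesis using False by (simp add: k_def)
next
  case True
  define v where "v = fls_subdegree y"
  have y: "y \<noteq> 0" using True by auto
  have inv: "ord_ge (- B - v) (f * inverse y)" if "ord_ge (- B) f" for f
    using ord_ge_mult[OF that, of "inverse y" "- v"] by (simp add: v_def)
  have "ord_ge (- B - v) (coeff Q i)"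
  proof (induction i)
    case 0
    have "coeff ([:-y, 1:] * Q) 0 = - (y * coeff Q 0)" by simp
    hence "coeff Q 0 = - coeff ([:-y, 1:] * Q) 0 * inverse y" using y by (simp add: field_simps)
    moreover have "ord_ge (- B) (- coeff ([:-y, 1:] * Q) 0)" by (rule ord_ge_uminus[OF assms])
    ultimately show ?case using inv by (simp only:)
  next
    case (Suc i)
    have "coeff ([:-y, 1:] * Q) (Suc i) = coeff Q i - y * coeff Q (Suc i)" by simp
    hence *: "coeff Q (Suc i) = (coeff Q i + - coeff ([:-y, 1:] * Q) (Suc i)) * inverse y"
      using y by (simp add: divide_inverse[symmetric])
    have "ord_ge (- B) (coeff Q i)" using Suc True by (auto simp: v_def)
    moreover have "ord_ge (- B) (- coeff ([:-y, 1:] * Q) (Suc i))"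
      by (rule ord_ge_uminus[OF assms])
    ultimately have "ord_ge (- B) (coeff Q i + - coeff ([:-y, 1:] * Q) (Suc i))" by (rule ord_ge_add)
    thus ?case unfolding * by (rule inv)
  qed
  thus ?thesis using True by (simp add: v_def max_def algebra_simps)
qed

text \<open>Each division by \<open>Y - y\<close> lowers \<open>B\<close> by the pole order of
  \<open>y\<close>. The leading coefficient of \<open>Q\<close>, of order at most 0, keeps the final
  bound from being negative.\<close>

lemma sum_root_poles_le:
  fixes Q :: "'a::field fls poly"
  assumes "\<And>i. ord_ge (- B) (coeff (Q * (\<Prod>y\<leftarrow>ys. [:-y, 1:])) i)"
    and "Q \<noteq> 0" "fls_subdegree (lead_coeff Q) \<le> 0"
  shows "(\<Sum>y\<leftarrow>ys. max 0 (- fls_subdegree y)) \<le> B"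
  using assms(1)
proof (induction ys arbitrary: B)
  case Nil
  have "lead_coeff Q \<noteq> 0" using assms(2) by simp
  thus ?case using assms(3) Nil[of "degree Q"] by simp
next
  case (Cons y ys)
  have "Q * (\<Prod>y\<leftarrow>y # ys. [:-y, 1:]) = [:-y, 1:] * (Q * (\<Prod>y\<leftarrow>ys. [:-y, 1:]))"
    by (simp only: list.map prod_list.Cons mult_ac)
  with Cons.prems have "ord_ge (- B) (coeff ([:-y, 1:] * (Q * (\<Prod>y\<leftarrow>ys. [:-y, 1:]))) i)" for i
    by simp
  from Cons.IH[OF ord_ge_coeff_linear_factor[OF this]] show ?case by simp
qed

text \<open>Reversing the coefficients inverts the roots and makes \<open>coeff K 0\<close> the
  leading coefficient, so zeros are counted as poles by \<open>sum_root_poles_le\<close>.\<close>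

lemma sum_root_zeros_le:
  fixes Q :: "'a::field fls poly"
  assumes "\<And>i. ord_ge (- B) (coeff K i)" and K: "K = Q * (\<Prod>y\<leftarrow>ys. [:-y, 1:])"
    and "coeff K 0 \<noteq> 0" "fls_subdegree (coeff K 0) \<le> 0"
  shows "(\<Sum>y\<leftarrow>ys. max 0 (fls_subdegree y)) \<le> B"
proof -
  have nz: "y \<noteq> 0" if "y \<in> set ys" for y
  proof
    assume "y = 0"
    with that have "[:0, 1:] dvd (\<Prod>y\<leftarrow>ys. [:-y, 1:])"
      by (intro prod_list_dvd) force
    hence "[:0, 1:] dvd K" using K by simp
    thus False using assms(3) by (auto simp: dvd_def)
  qed
  have prod: "reflect_poly (\<Prod>y\<leftarrow>ys. [:-y, 1:]) =
      smult (\<Prod>y\<leftarrow>ys. - y) (\<Prod>y\<leftarrow>map inverse ys. [:-y, 1:])" using nz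
  proof (induction ys)
    case (Cons y ys)
    have "reflect_poly [:-y, 1:] = smult (- y) [:- inverse y, 1:]"
      using Cons.prems by (simp add: reflect_poly_pCons' monom_Suc monom_0)
    moreover have "reflect_poly (\<Prod>y\<leftarrow>ys. [:-y, 1:]) =
        smult (\<Prod>y\<leftarrow>ys. - y) (\<Prod>y\<leftarrow>map inverse ys. [:-y, 1:])" using Cons by simp
    ultimately show ?case
      by (simp only: list.map prod_list.Cons reflect_poly_mult mult_smult_left mult_smult_right smult_smult)
         (simp only: mult.commute)
  qed (simp add: reflect_poly_1)
  define R where "R = smult (\<Prod>y\<leftarrow>ys. - y) (reflect_poly Q)"
  have R: "reflect_poly K = R * (\<Prod>y\<leftarrow>map inverse ys. [:-y, 1:])"
    unfolding K reflect_poly_mult prod R_def by simp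
  have lc: "lead_coeff (reflect_poly K) = coeff K 0" using assms(3) by (simp add: coeff_reflect_poly)
  have "lead_coeff (\<Prod>y\<leftarrow>map inverse ys. [:-y, 1:]) = 1"
    by (induction ys) (auto simp: lead_coeff_mult simp del: mult_pCons_left mult_pCons_right)
  hence lR: "lead_coeff R = coeff K 0" using lc unfolding R lead_coeff_mult by simp
  have "(\<Sum>y\<leftarrow>map inverse ys. max 0 (- fls_subdegree y)) \<le> B"
  proof (rule sum_root_poles_le[where Q = R])
    show "ord_ge (- B) (coeff (R * (\<Prod>y\<leftarrow>map inverse ys. [:-y, 1:])) i)" for i
      unfolding R[symmetric] using assms(1) by (simp add: coeff_reflect_poly)
  qed (use lR assms(3,4) in auto)
  also have "(\<Sum>y\<leftarrow>map inverse ys. max 0 (- fls_subdegree y)) = (\<Sum>y\<leftarrow>ys. max 0 (fls_subdegree y))"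
    by (simp add: o_def)
  finally show ?thesis .
qed

lemma distinct_roots_prod_dvd:
  fixes P :: "'a::idom poly"
  assumes "distinct ys" "\<And>y. y \<in> set ys \<Longrightarrow> poly P y = 0"
  shows "(\<Prod>y\<leftarrow>ys. [:-y, 1:]) dvd P"
  using assms
proof (induction ys arbitrary: P)
  case (Cons y ys)
  obtain Q where Q: "P = [:-y, 1:] * Q" using Cons.prems(2)[of y] by (auto simp: poly_eq_0_iff_dvd dvd_def)
  have "poly Q z = 0" if "z \<in> set ys" for z
    using Cons.prems(1) Cons.prems(2)[of z] that Q by auto
  hence "(\<Prod>y\<leftarrow>ys. [:-y, 1:]) dvd Q" using Cons by auto
  thus ?case unfolding Q by (simp add: mult_dvd_mono del: mult_pCons_left)
qed auto

subsection \<open>Evaluating bivariate polynomials at Laurent series\<close>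

interpretation fls_const: inj_idom_hom "fls_const :: 'a::idom \<Rightarrow> 'a fls"
  by unfold_locales (simp_all add: fls_plus_const[symmetric])

interpretation fls_const_poly: map_poly_inj_idom_hom "fls_const :: 'a::idom \<Rightarrow> 'a fls" ..

definition ev1 :: "complex fls \<Rightarrow> complex poly \<Rightarrow> complex fls" where
  "ev1 b p = poly (map_poly fls_const p) b"

text \<open>In \<open>ev b c P\<close> the inner variable of \<open>P\<close> takes the value \<open>b\<close> and the outer one the value \<open>c\<close>.\<close>
definition ev :: "complex fls \<Rightarrow> complex fls \<Rightarrow> complex poly poly \<Rightarrow> complex fls" where
  "ev b c P = poly (map_poly (ev1 b) P) c"

interpretation ev1: idom_hom "ev1 b"
  unfolding ev1_def by unfold_locales (simp_all add: fls_const_poly.hom_add fls_const_poly.hom_mult)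

interpretation ev1_poly: map_poly_idom_hom "ev1 b" ..

interpretation ev: idom_hom "ev b c"
  unfolding ev_def by unfold_locales (simp_all add: ev1_poly.hom_add ev1_poly.hom_mult)

lemma ev1_pCons [simp]: "ev1 b (pCons a p) = fls_const a + b * ev1 b p"
  by (simp add: ev1_def fls_const.map_poly_pCons_hom)

lemma ev_pCons [simp]: "ev b c (pCons p P) = ev1 b p + c * ev b c P"
  by (simp add: ev_def ev1.map_poly_pCons_hom)

lemma ev_smult [simp]: "ev b c (smult p P) = ev1 b p * ev b c P"
  by (simp add: ev_def ev1.map_poly_hom_smult)

lemma ev1_smult [simp]: "ev1 b (smult a p) = fls_const a * ev1 b p"
  by (simp add: ev1_def fls_const.map_poly_hom_smult)

lemma ev_fls_const: "ev b (fls_const a) P = ev1 b (poly P [:a:])"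
  by (induction P) (simp_all add: ev1.hom_add ev1.hom_mult)

lemma ev_monom [simp]: "ev b c (monom p n) = ev1 b p * c ^ n"
  by (simp add: ev_def map_poly_monom poly_monom)

definition nonconstant :: "'a::zero fls \<Rightarrow> bool" where
  "nonconstant b \<longleftrightarrow> (\<forall>a. b \<noteq> fls_const a)"

text \<open>Over the complex numbers \<open>p\<close> splits into linear factors, and no
  \<open>b - a\<close> vanishes. Thus \<open>nonconstant b\<close> means that \<open>b\<close> is
  transcendental.\<close>

lemma ev1_eq_0_iff:
  assumes "nonconstant b" shows "ev1 b p = 0 \<longleftrightarrow> p = 0"
proof (induction "degree p" arbitrary: p rule: less_induct)
  case less
  show ?case
  proof (cases "degree p = 0")
    case True
    then obtain a where "p = [:a:]" by (meson degree_eq_zeroE)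
    thus ?thesis by simp
  next
    case False
    obtain a where "poly p a = 0"
      using False by (metis fundamental_theorem_of_algebra constant_degree)
    then obtain q where q: "p = [:-a, 1:] * q" by (auto simp: poly_eq_0_iff_dvd dvd_def)
    hence "q \<noteq> 0" using False by auto
    hence "degree q < degree p" unfolding q by (subst degree_mult_eq) auto
    moreover have "b \<noteq> fls_const a" using assms by (simp add: nonconstant_def)
    moreover have "ev1 b p = (b - fls_const a) * ev1 b q" unfolding q ev1.hom_mult by simp
    ultimately show ?thesis using less[of q] \<open>q \<noteq> 0\<close> q by auto
  qed
qed

text \<open>A form of Gauss's lemma. By pseudo-division, a vanishing \<open>P\<close> of least outer
  degree divides some \<open>smult l R\<close> for every vanishing \<open>R\<close>. As
  \<open>b\<close> is transcendental, \<open>F\<close> has positive outer degree, so this prime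
  divides no \<open>[:l:]\<close> with \<open>l \<noteq> 0\<close>; it divides \<open>P\<close> and
  therefore \<open>Q\<close>.\<close>

lemma irreducible_dvd_if_ev_eq_0:
  assumes F: "Factorial_Ring.irreducible F" "ev b c F = 0" and b: "nonconstant b"
    and Q: "ev b c Q = 0"
  shows "F dvd Q"
proof -
  define k where "k = (LEAST k. \<exists>P. P \<noteq> 0 \<and> ev b c P = 0 \<and> degree P = k)"
  have F0: "F \<noteq> 0" using F by auto
  have ex: "\<exists>k P. P \<noteq> 0 \<and> ev b c P = 0 \<and> degree P = k" using F F0 by blast
  obtain P where P: "P \<noteq> 0" "ev b c P = 0" "degree P = k"
    using LeastI_ex[OF ex] unfolding k_def by blast
  have min: "k \<le> degree R" if "R \<noteq> 0" "ev b c R = 0" for R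
    unfolding k_def using that by (intro Least_le) blast
  have degpos: "degree R > 0" if "R \<noteq> 0" "ev b c R = 0" for R
  proof (rule ccontr)
    assume "\<not> degree R > 0"
    then obtain r where r: "R = [:r:]" by (meson degree_eq_zeroE not_gr0)
    hence "ev1 b r = 0" using that by simp
    thus False using ev1_eq_0_iff[OF b] r that by simp
  qed
  have dvd: "\<exists>l. l \<noteq> 0 \<and> P dvd smult l R" if "ev b c R = 0" for R
  proof -
    have "\<exists>a q. a \<noteq> 0 \<and> smult a R = P * q + pseudo_mod R P"
      by (rule pseudo_mod(1)[OF P(1)])
    then obtain a q where aq: "a \<noteq> 0" "smult a R = P * q + pseudo_mod R P"
      by (elim exE conjE)
    have r: "pseudo_mod R P = 0 \<or> degree (pseudo_mod R P) < degree P"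
      by (rule pseudo_mod(2)[OF P(1)])
    have "pseudo_mod R P = smult a R - P * q" using aq by simp
    hence "ev b c (pseudo_mod R P) = 0" using that P(2) by (simp add: ev.hom_minus ev.hom_mult)
    hence "pseudo_mod R P = 0" using r min[of "pseudo_mod R P"] P(3) by (metis leD)
    thus ?thesis using aq by (intro exI[of _ a]) auto
  qed
  have prime: "prime_elem F" using F(1) by (rule irreducible_imp_prime_elem)
  have notdvd: "\<not> F dvd [:l:]" if "l \<noteq> 0" for l
  proof
    assume "F dvd [:l:]"
    hence "degree F \<le> degree [:l:]" using that by (intro dvd_imp_degree_le) auto
    thus False using degpos[OF F0 F(2)] by simp
  qed
  have smult: "F dvd R" if "F dvd smult l R" "l \<noteq> 0" for l R
    using that notdvd prime prime_elem_dvd_mult_iff[of F "[:l:]" R] by simp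
  obtain l where l: "l \<noteq> 0" "P dvd smult l F" using dvd[OF F(2)] by blast
  then obtain S where S: "smult l F = P * S" by (auto simp: dvd_def)
  \<comment> \<open>If \<open>F\<close> divided the cofactor \<open>S\<close> instead, cancelling
    \<open>F\<close> would leave \<open>[:l:]\<close> as a multiple of \<open>P\<close>, whose outer
    degree is positive.\<close>
  have "F dvd P"
  proof (rule ccontr)
    assume "\<not> F dvd P"
    hence "F dvd S" using prime S by (metis dvd_refl dvd_smult prime_elem_dvd_mult_iff)
    then obtain T where "S = F * T" by (auto simp: dvd_def)
    hence "F * [:l:] = F * (P * T)" using S by (simp add: mult_ac)
    hence lPT: "[:l:] = P * T" using F0 by (simp only: mult_cancel_left) simp
    hence "T \<noteq> 0" using l by auto
    hence "degree [:l:] = degree P + degree T" unfolding lPT using P(1) by (simp add: degree_mult_eq)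
    thus False using degpos[OF P(1,2)] by simp
  qed
  moreover obtain l' where "l' \<noteq> 0" "P dvd smult l' Q" using dvd[OF Q] by blast
  ultimately show ?thesis using smult dvd_trans by blast
qed

lemma ev_irreducible_factor:
  assumes "P \<noteq> 0" "ev b c P = 0"
  shows "\<exists>F. Factorial_Ring.irreducible F \<and> F dvd P \<and> ev b c F = 0"
proof -
  have "ev b c P = 0 \<longrightarrow> (\<exists>F. Factorial_Ring.irreducible F \<and> F dvd P \<and> ev b c F = 0)"
    using assms(1)
  proof (induction P rule: prime_divisors_induct)
    case (unit P)
    hence "ev b c P dvd 1" using ev.hom_dvd_1 by blast
    thus ?case by auto
  next
    case (factor p P)
    have "Factorial_Ring.irreducible p" using factor by (simp add: prime_elem_imp_irreducible)
    thus ?case using factor by (auto simp: ev.hom_mult intro: dvd_mult)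
  qed simp
  thus ?thesis using assms by blast
qed

subsection \<open>Exchanging the variables and the inner degree\<close>

definition swap_vars :: "complex poly poly \<Rightarrow> complex poly poly" where
  "swap_vars P = poly (map_poly (map_poly (\<lambda>a. [:a:])) P) [:[:0, 1:]:]"

interpretation coeff_lift_hom: map_poly_inj_idom_hom "\<lambda>a :: complex. [:a:]"
  by unfold_locales (auto simp: one_pCons)

interpretation coeff_lift_poly: map_poly_inj_idom_hom "map_poly (\<lambda>a :: complex. [:a:])" ..

interpretation swap_vars: idom_hom swap_vars
  unfolding swap_vars_def by unfold_locales (simp_all add: coeff_lift_poly.hom_add coeff_lift_poly.hom_mult)

lemma swap_vars_pCons:
  "swap_vars (pCons p P) = map_poly (\<lambda>a. [:a:]) p + [:[:0, 1:]:] * swap_vars P"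
  by (simp add: swap_vars_def Polynomial.map_poly_pCons)

lemma coeff_swap_vars: "coeff (coeff (swap_vars P) j) i = coeff (coeff P i) j"
proof (induction P arbitrary: i)
  case (pCons p P)
  have "coeff (swap_vars (pCons p P)) j = pCons (coeff p j) (coeff (swap_vars P) j)"
    by (simp add: swap_vars_pCons coeff_map_poly)
  thus ?case using pCons by (simp add: coeff_pCons split: nat.split)
qed simp

lemma swap_vars_swap_vars [simp]: "swap_vars (swap_vars P) = P"
  by (intro poly_eqI) (simp add: coeff_swap_vars)

lemma swap_vars_eq_0_iff [simp]: "swap_vars P = 0 \<longleftrightarrow> P = 0"
  by (metis swap_vars.hom_zero swap_vars_swap_vars)

lemma ev_swap_vars: "ev b c (swap_vars P) = ev c b P"
proof (induction P)
  case (pCons p P)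
  have "ev b c (map_poly (\<lambda>a. [:a:]) p) = ev1 c p"
    by (induction p) (simp_all add: Polynomial.map_poly_pCons)
  thus ?case using pCons by (simp add: swap_vars_pCons ev.hom_add ev.hom_mult)
qed simp

text \<open>This carries facts on \<open>degree\<close>, such as monotonicity under divisibility,
  over to the inner degree.\<close>

lemma inner_degree_eq: "inner_degree P = degree (swap_vars P)"
proof (rule antisym)
  show "inner_degree P \<le> degree (swap_vars P)"
    unfolding inner_degree_def
  proof (rule Max.boundedI; clarsimp?)
    fix i show "degree (coeff P i) \<le> degree (swap_vars P)"
    proof (rule degree_le, intro allI impI)
      fix j assume "degree (swap_vars P) < j"
      thus "coeff (coeff P i) j = 0" by (metis coeff_0 coeff_eq_0 coeff_swap_vars)
    qed
  qed
  show "degree (swap_vars P) \<le> inner_degree P"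
  proof (rule degree_le, intro allI impI)
    fix j assume j: "inner_degree P < j"
    have "coeff (coeff P i) j = 0" for i
    proof (cases "i \<le> degree P")
      case True
      hence "degree (coeff P i) \<le> inner_degree P" unfolding inner_degree_def by (intro Max_ge) auto
      thus ?thesis using j by (intro coeff_eq_0) auto
    qed (simp add: coeff_eq_0)
    thus "coeff (swap_vars P) j = 0" by (intro poly_eqI) (simp add: coeff_swap_vars)
  qed
qed

lemma inner_degree_swap_vars: "inner_degree (swap_vars P) = outer_degree P"
  by (simp add: inner_degree_eq outer_degree_def)

lemma outer_degree_swap_vars: "outer_degree (swap_vars P) = inner_degree P"
  by (simp add: inner_degree_eq outer_degree_def)

lemma outer_degree_dvd: "P dvd Q \<Longrightarrow> Q \<noteq> 0 \<Longrightarrow> outer_degree P \<le> outer_degree Q"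
  by (simp add: outer_degree_def dvd_imp_degree_le)

lemma inner_degree_dvd: "P dvd Q \<Longrightarrow> Q \<noteq> 0 \<Longrightarrow> inner_degree P \<le> inner_degree Q"
  unfolding inner_degree_eq by (intro dvd_imp_degree_le swap_vars.hom_dvd) auto

lemma degree_coeff_le_inner_degree: "degree (coeff P i) \<le> inner_degree P"
  unfolding inner_degree_eq by (intro degree_le allI impI) (metis coeff_0 coeff_eq_0 coeff_swap_vars)

subsection \<open>Algebraic relations for elements of a field generated by two elements\<close>

text \<open>There are more vectors than coordinates. The elimination avoids division: a pivot
  \<open>R j\<close> clears the coefficient of index \<open>t\<close> in the others by cross
  multiplication.\<close>

lemma polys_linear_dependent:
  fixes R :: "'i \<Rightarrow> 'a::idom poly"
  assumes "finite I" "card I > t" "\<And>i k. i \<in> I \<Longrightarrow> k \<ge> t \<Longrightarrow> coeff (R i) k = 0"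
  shows "\<exists>c. (\<exists>i\<in>I. c i \<noteq> 0) \<and> (\<Sum>i\<in>I. smult (c i) (R i)) = 0"
  using assms
proof (induction t arbitrary: I R)
  case 0
  then obtain i where "i \<in> I" by fastforce
  moreover have "R i = 0" if "i \<in> I" for i using 0(3)[OF that] by (intro poly_eqI) simp
  ultimately show ?case by (intro exI[of _ "\<lambda>_. 1"]) auto
next
  case (Suc t)
  show ?case
  proof (cases "\<forall>i\<in>I. coeff (R i) t = 0")
    case True
    hence "coeff (R i) k = 0" if "i \<in> I" "k \<ge> t" for i k
      using Suc.prems(3)[of i k] that by (cases "k = t") auto
    thus ?thesis using Suc.prems by (intro Suc.IH) auto
  next
    case False
    then obtain j where j: "j \<in> I" "coeff (R j) t \<noteq> 0" by blast
    define a where "a = coeff (R j) t"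
    define T where "T i = smult a (R i) - smult (coeff (R i) t) (R j)" for i
    have "\<exists>c. (\<exists>i\<in>I - {j}. c i \<noteq> 0) \<and> (\<Sum>i\<in>I - {j}. smult (c i) (T i)) = 0"
    proof (rule Suc.IH)
      fix i k assume "i \<in> I - {j}" "t \<le> k"
      thus "coeff (T i) k = 0" using Suc.prems(3)[of i k] Suc.prems(3)[OF j(1), of k]
        by (cases "k = t") (auto simp: T_def a_def)
    qed (use Suc.prems j in auto)
    then obtain c i where c: "i \<in> I - {j}" "c i \<noteq> 0" "(\<Sum>i\<in>I - {j}. smult (c i) (T i)) = 0" by blast
    \<comment> \<open>The weight at \<open>j\<close> compensates the multiples of \<open>R j\<close>
      that were subtracted in the \<open>T i\<close>.\<close>
    define e where "e i = (if i = j then - (\<Sum>i\<in>I - {j}. c i * coeff (R i) t) else a * c i)" for i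
    have "(\<Sum>i\<in>I. smult (e i) (R i)) = smult (e j) (R j) + (\<Sum>i\<in>I - {j}. smult (e i) (R i))"
      using Suc.prems j by (simp add: sum.remove)
    also have "(\<Sum>i\<in>I - {j}. smult (e i) (R i)) = (\<Sum>i\<in>I - {j}. smult (c i) (T i) + smult (c i * coeff (R i) t) (R j))"
      by (intro sum.cong) (auto simp: e_def T_def algebra_simps smult_diff_right)
    also have "\<dots> = smult (\<Sum>i\<in>I - {j}. c i * coeff (R i) t) (R j)"
      by (simp add: sum.distrib c smult_sum)
    also have "smult (e j) (R j) + \<dots> = 0" by (simp add: e_def smult_add_left[symmetric] del: smult_minus_left)
    finally have "(\<Sum>i\<in>I. smult (e i) (R i)) = 0" .
    moreover have "e i \<noteq> 0" "i \<in> I" using c j by (auto simp: e_def a_def)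
    ultimately show ?thesis by blast
  qed
qed

text \<open>If \<open>t\<close> is the degree of \<open>H\<close> in the outer variable, then \<open>\<complex>(b, c)\<close> is spanned by the powers
  \<open>1, \<dots>, c\<^sup>t\<^sup>-\<^sup>1\<close> over \<open>\<complex>(b)\<close>; hence \<open>1, w, \<dots>, w\<^sup>t\<close> are linearly dependent over \<open>\<complex>(b)\<close>.\<close>
lemma algebraic_relation:
  assumes H: "H \<noteq> 0" "ev b c H = 0" and b: "nonconstant b"
    and w: "w * ev b c B = ev b c A" "ev b c B \<noteq> 0"
  shows "\<exists>P. P \<noteq> 0 \<and> ev b w P = 0 \<and> outer_degree P \<le> outer_degree H"
proof -
  define t where "t = degree H"
  have "t > 0"
  proof (rule ccontr)
    assume "\<not> t > 0"
    then obtain h where "H = [:h:]" unfolding t_def by (meson degree_eq_zeroE not_gr0)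
    thus False using H ev1_eq_0_iff[OF b] by simp
  qed
  \<comment> \<open>At \<open>(b, c)\<close> the polynomial \<open>A^i B^(t-i)\<close> takes the
    value \<open>w^i\<close> times the common factor \<open>B^t\<close>; its pseudo-remainder has
    only \<open>t\<close> coefficients, while \<open>i\<close> runs through \<open>t + 1\<close>
    values.\<close>
  define R where "R i = pseudo_mod (A ^ i * B ^ (t - i)) H" for i
  have "\<forall>i. \<exists>a q. a \<noteq> 0 \<and> smult a (A ^ i * B ^ (t - i)) = H * q + R i"
    unfolding R_def using pseudo_mod(1)[OF H(1)] by blast
  then obtain a q where a: "\<And>i. a i \<noteq> 0" "\<And>i. smult (a i) (A ^ i * B ^ (t - i)) = H * q i + R i"
    by metis
  have "coeff (R i) k = 0" if "k \<ge> t" for i k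
    using pseudo_mod(2)[OF H(1), of "A ^ i * B ^ (t - i)"] that \<open>t > 0\<close>
    by (auto simp: R_def t_def intro: coeff_eq_0)
  then obtain e where e: "\<exists>i\<in>{..t}. e i \<noteq> 0" "(\<Sum>i\<in>{..t}. smult (e i) (R i)) = 0"
    using polys_linear_dependent[of "{..t}" t R] by auto
  define P where "P = (\<Sum>i\<le>t. monom (e i * a i) i)"
  have coeff: "coeff P i = (if i \<le> t then e i * a i else 0)" for i
    by (simp add: P_def coeff_sum)
  have "P \<noteq> 0" using e(1) a(1) coeff by (metis atMost_iff coeff_0 mult_eq_0_iff)
  moreover have "degree P \<le> t" by (intro degree_le) (auto simp: coeff)
  moreover have "ev b w P = 0"
  proof -
    have R: "ev b c (R i) = ev1 b (a i) * w ^ i * ev b c B ^ t" if "i \<le> t" for i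
    proof -
      have "ev b c (R i) = ev1 b (a i) * (ev b c A ^ i * ev b c B ^ (t - i))"
        using arg_cong[OF a(2)[of i], of "ev b c"] H(2)
        by (simp add: ev.hom_add ev.hom_mult ev.hom_power)
      also have "ev b c A ^ i * ev b c B ^ (t - i) = w ^ i * (ev b c B ^ i * ev b c B ^ (t - i))"
        unfolding w(1)[symmetric] by (simp add: power_mult_distrib mult_ac)
      finally show ?thesis using that by (simp add: power_add[symmetric] mult_ac)
    qed
    have "0 = ev b c (\<Sum>i\<in>{..t}. smult (e i) (R i))" by (simp add: e(2))
    also have "\<dots> = (\<Sum>i\<le>t. ev1 b (e i) * (ev1 b (a i) * w ^ i * ev b c B ^ t))"
      by (simp add: ev.hom_sum R)
    also have "\<dots> = ev b w P * ev b c B ^ t"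
      by (simp add: P_def ev.hom_sum ev1.hom_mult sum_distrib_right sum_distrib_left mult_ac)
    finally show ?thesis using w(2) by simp
  qed
  ultimately show ?thesis by (auto simp: outer_degree_def t_def)
qed

subsection \<open>Derivation of Puiseux series\<close>

text \<open>By the chain rule \<open>u\<close> is dt/dx. The rules for \<open>fls_deriv\<close> thus
  carry over to finite points and to infinity alike.\<close>

lemma puiseux_deriv_eq_mult_fls_deriv: "\<exists>u. \<forall>f. puiseux_deriv pt n f = u * fls_deriv f"
proof (cases pt)
  case (At x0)
  show ?thesis unfolding At
    by (intro exI[of _ "fls_const (1 / of_nat n) * fls_X_intpow (1 - int n)"])
       (simp add: fls_shifted_times_simps)
next
  case At_infinity
  show ?thesis unfolding At_infinity
    by (intro exI[of _ "fls_const (- 1 / of_nat n) * fls_X_intpow (int n + 1)"])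
       (simp add: fls_shifted_times_simps)
qed

locale puiseux =
  fixes pt :: expansion_point and n :: nat
  assumes n_pos: "n > 0"
begin

abbreviation "D \<equiv> puiseux_deriv pt n"
abbreviation "x \<equiv> puiseux_x pt n"

lemma deriv_add: "D (f + g) = D f + D g"
  using puiseux_deriv_eq_mult_fls_deriv[of pt n] by (auto simp: distrib_left)

lemma deriv_mult: "D (f * g) = D f * g + f * D g"
  using puiseux_deriv_eq_mult_fls_deriv[of pt n] by (auto simp: algebra_simps)

lemma deriv_const [simp]: "D (fls_const a) = 0"
  using puiseux_deriv_eq_mult_fls_deriv[of pt n] by auto

lemma deriv_0 [simp]: "D 0 = 0"
  using puiseux_deriv_eq_mult_fls_deriv[of pt n] by auto

lemma deriv_1 [simp]: "D 1 = 0"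
  using puiseux_deriv_eq_mult_fls_deriv[of pt n] by auto

lemma deriv_x: "D x = 1"
proof (rule fls_eqI)
  fix m show "fls_nth (D x) m = fls_nth 1 m"
    using n_pos by (cases pt) (auto simp: fls_X_power_nth fls_X_inv_power_nth)
qed

lemma deriv_minus: "D (f - g) = D f - D g"
  using deriv_add[of "f - g" g] by simp

lemma deriv_eq_0:
  assumes "D f = 0" shows "\<exists>a. f = fls_const a"
proof -
  obtain u where u: "\<And>f. D f = u * fls_deriv f" using puiseux_deriv_eq_mult_fls_deriv by blast
  have "u \<noteq> 0" using deriv_x u[of x] by auto
  hence "fls_deriv f = 0" using u assms by auto
  hence "f = fls_const (fls_nth f 0)"
    by (intro fls_eqI) (metis add.commute diff_add_cancel fls_const_nth fls_deriv_nth fls_zero_nth mult_eq_0_iff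
        of_int_eq_0_iff)
  thus ?thesis by blast
qed

lemma deriv_eq_imp_diff_const: "D f = D g \<Longrightarrow> \<exists>a. f = g + fls_const a"
  using deriv_eq_0[of "f - g"] by (auto simp: deriv_minus algebra_simps)

lemma nonconstant_x: "nonconstant x"
  unfolding nonconstant_def using deriv_x by (metis deriv_const zero_neq_one)

lemma deriv_ev1: "D (ev1 b p) = ev1 b (pderiv p) * D b"
  by (induction p) (auto simp: pderiv_pCons deriv_add deriv_mult ev1.hom_add algebra_simps)

text \<open>Chain rule: \<open>map_poly pderiv\<close> is the partial derivative in the inner
  variable, \<open>pderiv\<close> the one in the outer variable.\<close>

lemma deriv_ev: "D (ev b c P) = ev b c (map_poly pderiv P) * D b + ev b c (pderiv P) * D c"
proof (induction P)
  case (pCons p P)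
  have "map_poly pderiv (pCons p P) = pCons (pderiv p) (map_poly pderiv P)"
    by (simp add: Polynomial.map_poly_pCons)
  thus ?case using pCons
    by (simp add: pderiv_pCons deriv_add deriv_mult deriv_ev1 ev.hom_add algebra_simps)
qed simp

text \<open>Otherwise \<open>F\<close> would divide \<open>pderiv F\<close>, hence have outer degree
  0, and a nonzero polynomial in the inner variable alone cannot vanish at the transcendental
  \<open>b\<close>.\<close>

lemma pderiv_irreducible_nonzero:
  assumes "Factorial_Ring.irreducible F" "ev b c F = 0" "nonconstant b"
  shows "ev b c (pderiv F) \<noteq> 0"
proof
  assume "ev b c (pderiv F) = 0"
  hence "F dvd pderiv F" using assms irreducible_dvd_if_ev_eq_0 by blast
  hence "degree F = 0"
    by (metis degree_pderiv diff_less dvd_imp_degree_le le_0_eq less_numeral_extra(1) linorder_not_le neq0_conv pderiv_eq_0_iff)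
  then obtain f where "F = [:f:]" by (meson degree_eq_zeroE)
  thus False using assms by (auto simp: ev1_eq_0_iff)
qed

end

section \<open>The field \<complex>(b, c), and \<complex>(y, y') as a differential field containing
  \<open>x\<close>\<close>

definition generated_field :: "complex fls \<Rightarrow> complex fls \<Rightarrow> complex fls set" where
  "generated_field b c = {w. \<exists>A B. ev b c B \<noteq> 0 \<and> w * ev b c B = ev b c A}"

lemma generated_field_ev: "ev b c A \<in> generated_field b c"
  unfolding generated_field_def by (intro CollectI exI[of _ A] exI[of _ 1]) simp

lemma generated_field_const: "fls_const a \<in> generated_field b c"
  using generated_field_ev[of b c "[:[:a:]:]"] by simp

lemma generated_field_add:
  assumes "v \<in> generated_field b c" "w \<in> generated_field b c"
  shows "v + w \<in> generated_field b c"
proof -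
  obtain A B A' B' where "ev b c B \<noteq> 0" "v * ev b c B = ev b c A"
    "ev b c B' \<noteq> 0" "w * ev b c B' = ev b c A'"
    using assms unfolding generated_field_def by blast
  moreover have "(v + w) * (ev b c B * ev b c B') =
      v * ev b c B * ev b c B' + w * ev b c B' * ev b c B" by (simp add: algebra_simps)
  ultimately show ?thesis unfolding generated_field_def
    by (intro CollectI exI[of _ "A * B' + A' * B"] exI[of _ "B * B'"]) (simp add: ev.hom_add ev.hom_mult)
qed

lemma generated_field_mult:
  assumes "v \<in> generated_field b c" "w \<in> generated_field b c"
  shows "v * w \<in> generated_field b c"
proof -
  obtain A B A' B' where "ev b c B \<noteq> 0" "v * ev b c B = ev b c A"
    "ev b c B' \<noteq> 0" "w * ev b c B' = ev b c A'"
    using assms unfolding generated_field_def by blast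
  moreover have "v * w * (ev b c B * ev b c B') = v * ev b c B * (w * ev b c B')"
    by (simp add: algebra_simps)
  ultimately show ?thesis unfolding generated_field_def
    by (intro CollectI exI[of _ "A * A'"] exI[of _ "B * B'"]) (simp add: ev.hom_mult)
qed

lemma generated_field_inverse:
  assumes "w \<in> generated_field b c" shows "inverse w \<in> generated_field b c"
proof (cases "w = 0")
  case True thus ?thesis using generated_field_const[of 0] by simp
next
  case False
  obtain A B where AB: "ev b c B \<noteq> 0" "w * ev b c B = ev b c A"
    using assms unfolding generated_field_def by blast
  hence "ev b c A \<noteq> 0" using False by auto
  moreover have "inverse w * ev b c A = ev b c B" using AB False by (simp add: field_simps)
  ultimately show ?thesis unfolding generated_field_def by blast
qed

lemma generated_field_uminus: "w \<in> generated_field b c \<Longrightarrow> - w \<in> generated_field b c"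
  using generated_field_mult[OF generated_field_const[of "-1"], of w b c]
  by (simp add: fls_const.hom_uminus)

context puiseux
begin

context
  fixes y F
  assumes y: "nonconstant y" and F: "Factorial_Ring.irreducible F" "ev y (D y) F = 0"
begin

text \<open>Differentiate \<open>F(y, y') = 0\<close> and solve for \<open>y''\<close>, whose
  coefficient is the nonzero value of \<open>pderiv F\<close>.\<close>

lemma deriv2_in_generated_field: "D (D y) \<in> generated_field y (D y)"
proof -
  have "D (ev y (D y) F) = 0" using F by simp
  hence "D (D y) * ev y (D y) (pderiv F) = ev y (D y) (- map_poly pderiv F * [:0, 1:])"
    unfolding deriv_ev by (simp add: ev.hom_mult ev.hom_uminus eq_neg_iff_add_eq_0 algebra_simps)
  thus ?thesis unfolding generated_field_def
    using pderiv_irreducible_nonzero[OF F y] by blast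
qed

lemma deriv_in_generated_field:
  assumes "w \<in> generated_field y (D y)" shows "D w \<in> generated_field y (D y)"
proof -
  let ?M = "generated_field y (D y)"
  have Dev: "D (ev y (D y) P) \<in> ?M" for P
    unfolding deriv_ev using generated_field_ev[of y "D y" "[:0, 1:]"] deriv2_in_generated_field
    by (intro generated_field_add generated_field_mult generated_field_ev) auto
  obtain A B where AB: "ev y (D y) B \<noteq> 0" "w * ev y (D y) B = ev y (D y) A"
    using assms unfolding generated_field_def by blast
  have "D w * ev y (D y) B + w * D (ev y (D y) B) = D (ev y (D y) A)"
    unfolding AB(2)[symmetric] by (simp add: deriv_mult)
  hence "D w = (D (ev y (D y) A) + - (w * D (ev y (D y) B))) * inverse (ev y (D y) B)"
    using AB(1) by (simp add: field_simps)
  also have "\<dots> \<in> ?M" by (intro generated_field_mult generated_field_add generated_field_uminus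
        generated_field_inverse Dev generated_field_ev assms)
  finally show ?thesis .
qed

text \<open>Differentiating the minimal polynomial \<open>X\<^sup>k + a X\<^sup>k\<^sup>-\<^sup>1 + \<dots>\<close> of \<open>x\<close> over the differential
  field \<open>\<complex>(y, y')\<close> gives a relation of smaller degree, so \<open>a' = - k\<close> and \<open>x = - a / k\<close> up to a constant.\<close>
lemma x_in_generated_field:
  assumes "G \<noteq> 0" "ev x y G = 0"
  shows "x \<in> generated_field y (D y)"
proof -
  let ?M = "generated_field y (D y)"
  define rel where "rel P \<longleftrightarrow> P \<noteq> 0 \<and> (\<forall>i. coeff P i \<in> ?M) \<and> poly P x = 0" for P
  \<comment> \<open>With \<open>y\<close> as the inner variable, \<open>G\<close> becomes a relation
    for \<open>x\<close> over \<complex>(y).\<close>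
  have "rel (map_poly (ev1 y) (swap_vars G))"
    unfolding rel_def
  proof (intro conjI allI)
    have "ev1 y (lead_coeff (swap_vars G)) \<noteq> 0" using assms(1) by (simp add: ev1_eq_0_iff[OF y])
    thus "map_poly (ev1 y) (swap_vars G) \<noteq> 0" by (metis coeff_0 coeff_map_poly ev1.hom_zero)
    show "coeff (map_poly (ev1 y) (swap_vars G)) i \<in> ?M" for i
      using generated_field_ev[of y "D y" "[:coeff (swap_vars G) i:]"] by (simp add: coeff_map_poly)
    show "poly (map_poly (ev1 y) (swap_vars G)) x = 0"
      using assms(2) ev_swap_vars[of y x G] by (simp add: ev_def)
  qed
  hence ex: "\<exists>k P. rel P \<and> degree P = k" by blast
  define k where "k = (LEAST k. \<exists>P. rel P \<and> degree P = k)"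
  obtain P where P: "rel P" "degree P = k" using LeastI_ex[OF ex] unfolding k_def by blast
  have min: "k \<le> degree R" if "rel R" for R
    unfolding k_def using that by (intro Least_le) blast
  define p where "p = smult (inverse (lead_coeff P)) P"
  have p: "lead_coeff p = 1" "degree p = k" "coeff p i \<in> ?M" "poly p x = 0" for i
    using P by (auto simp: p_def rel_def intro: generated_field_mult generated_field_inverse)
  have D_poly: "D (poly q z) = poly (map_poly D q) z + poly (pderiv q) z * D z" for q z
  proof (induction q)
    case (pCons a q)
    thus ?case by (simp add: Polynomial.map_poly_pCons pderiv_pCons deriv_add deriv_mult algebra_simps)
  qed simp
  have "k > 0"
  proof (rule ccontr)
    assume "\<not> k > 0"
    then obtain a where "p = [:a:]" using p(2) by (metis degree_eq_zeroE not_gr0)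
    thus False using p(1,4) by simp
  qed
  then obtain k' where k': "k = Suc k'" by (cases k) auto
  define q where "q = map_poly D p + pderiv p"
  have coeff_q: "coeff q i = D (coeff p i) + of_nat (Suc i) * coeff p (Suc i)" for i
    by (simp add: q_def coeff_map_poly coeff_pderiv)
  have "poly q x = 0" using D_poly[of p x] p(4) by (simp add: q_def deriv_x)
  moreover have "coeff q i \<in> ?M" for i
    unfolding coeff_q using p(3) generated_field_const[of "of_nat (Suc i)"]
    by (intro generated_field_add generated_field_mult deriv_in_generated_field) (auto simp: fls_of_nat)
  moreover have "degree q < k"
  proof -
    have "coeff q i = 0" if "i \<ge> k" for i
      using p(1,2) that by (cases "i = k") (auto simp: coeff_q coeff_eq_0)
    thus ?thesis using \<open>k > 0\<close> by (metis leading_coeff_0_iff degree_0 not_le)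
  qed
  ultimately have "q = 0" using min[of q] by (auto simp: rel_def)
  hence "D (coeff p k') + of_nat k = 0" using coeff_q[of k'] p(1,2) k' by simp
  hence "D (coeff p k' + of_nat k * x) = 0"
    using deriv_x deriv_const[of "of_nat k"] by (simp add: deriv_add deriv_mult fls_of_nat)
  then obtain a where a: "coeff p k' + of_nat k * x = fls_const a" using deriv_eq_0 by blast
  have nz: "(of_nat k :: complex fls) \<noteq> 0" using \<open>k > 0\<close> by simp
  have "x = (fls_const a + - coeff p k') * inverse (of_nat k)"
    using nz unfolding a[symmetric] by (simp add: field_simps)
  also have "\<dots> \<in> ?M"
    using p(3) generated_field_const[of "of_nat k"]
    by (intro generated_field_mult generated_field_add generated_field_uminus
        generated_field_inverse generated_field_const) (auto simp: fls_of_nat)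
  finally show ?thesis .
qed

text \<open>The relation for \<open>w = x\<close> over \<complex>(y) has \<open>y\<close> as its
  inner variable; after the swap it is a multiple of \<open>G\<close>.\<close>

lemma inner_degree_minimal_polynomial_le:
  assumes "Factorial_Ring.irreducible G" "ev x y G = 0"
  shows "inner_degree G \<le> outer_degree F"
proof -
  have "G \<noteq> 0" "F \<noteq> 0" using assms F by auto
  obtain A B where "ev y (D y) B \<noteq> 0" "x * ev y (D y) B = ev y (D y) A"
    using x_in_generated_field[OF \<open>G \<noteq> 0\<close> assms(2)] unfolding generated_field_def by blast
  then obtain P where P: "P \<noteq> 0" "ev y x P = 0" "outer_degree P \<le> outer_degree F"
    using algebraic_relation[OF \<open>F \<noteq> 0\<close> F(2) y] by metis
  have "G dvd swap_vars P"
    using assms P by (intro irreducible_dvd_if_ev_eq_0[OF _ _ nonconstant_x]) (auto simp: ev_swap_vars)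
  hence "inner_degree G \<le> inner_degree (swap_vars P)" using P by (intro inner_degree_dvd) auto
  thus ?thesis using P(3) by (simp add: inner_degree_swap_vars)
qed

text \<open>Here \<open>y\<close> and \<open>y'\<close> exchange roles: over \<complex>(y') the
  field is spanned by the first \<open>inner_degree F\<close> powers of \<open>y\<close>, which is
  why \<open>F\<close>, \<open>A\<close> and \<open>B\<close> enter swapped.\<close>

lemma relation_x_deriv:
  assumes "G \<noteq> 0" "ev x y G = 0" and "nonconstant (D y)"
  shows "\<exists>K. K \<noteq> 0 \<and> ev x (D y) K = 0 \<and> inner_degree K \<le> inner_degree F"
proof -
  have F0: "swap_vars F \<noteq> 0" using F by auto
  obtain A B where AB: "ev y (D y) B \<noteq> 0" "x * ev y (D y) B = ev y (D y) A"
    using x_in_generated_field[OF assms(1,2)] unfolding generated_field_def by blast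
  obtain P where P: "P \<noteq> 0" "ev (D y) x P = 0" "outer_degree P \<le> outer_degree (swap_vars F)"
    using algebraic_relation[OF F0 _ assms(3), of y x "swap_vars B" "swap_vars A"] F AB
    by (auto simp: ev_swap_vars)
  thus ?thesis
    by (intro exI[of _ "swap_vars P"])
       (auto simp: ev_swap_vars inner_degree_swap_vars outer_degree_swap_vars)
qed

end

end

subsection \<open>Conjugates at infinity\<close>

context puiseux
begin

text \<open>Clearing denominators in \<open>K(x, - G\<^sub>x / G\<^sub>Y)\<close> turns \<open>K(x, y') = 0\<close> into a polynomial relation between
  \<open>x\<close> and \<open>y\<close>, which passes to all conjugates of \<open>y\<close>.\<close>
lemma relation_transfer_poly:
  assumes "Factorial_Ring.irreducible G"
  shows "\<exists>Q. \<forall>pt' n'. n' > 0 \<longrightarrow> (\<forall>z. ev (puiseux_x pt' n') z G = 0 \<longrightarrow>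
    (ev (puiseux_x pt' n') z Q = 0 \<longleftrightarrow> ev (puiseux_x pt' n') (puiseux_deriv pt' n' z) K = 0))"
proof -
  define e where "e = degree K"
  \<comment> \<open>This is \<open>G_Y^e K(x, - G_x / G_Y)\<close>, a polynomial as \<open>e\<close>
    is the outer degree of \<open>K\<close>; the quotient \<open>- G_x / G_Y\<close> is the
    derivative of any root of \<open>G\<close>.\<close>
  define Q where "Q = (\<Sum>i\<le>e. smult (coeff K i) ((- map_poly pderiv G) ^ i * pderiv G ^ (e - i)))"
  show ?thesis
  proof (intro exI[of _ Q] allI impI)
    fix pt' n' z assume n': "(n' :: nat) > 0" and G: "ev (puiseux_x pt' n') z G = 0"
    interpret p: puiseux pt' n' using n' by unfold_locales
    let ?GY = "ev p.x z (pderiv G)"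
    have GY: "?GY \<noteq> 0" by (rule p.pderiv_irreducible_nonzero[OF assms G p.nonconstant_x])
    have "p.D (ev p.x z G) = 0" using G by simp
    hence Gx: "- ev p.x z (map_poly pderiv G) = p.D z * ?GY"
      unfolding p.deriv_ev p.deriv_x by (simp add: neg_eq_iff_add_eq_0 mult.commute)
    have "ev p.x z Q = (\<Sum>i\<le>e. ev1 p.x (coeff K i) * ((p.D z * ?GY) ^ i * ?GY ^ (e - i)))"
      unfolding Q_def ev.hom_sum
      by (intro sum.cong refl) (simp add: ev.hom_mult ev.hom_power ev.hom_uminus Gx)
    also have "\<dots> = (\<Sum>i\<le>e. ev1 p.x (coeff K i) * p.D z ^ i) * ?GY ^ e"
      unfolding sum_distrib_right
    proof (intro sum.cong refl)
      fix i assume "i \<in> {..e}"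
      hence "?GY ^ e = ?GY ^ i * ?GY ^ (e - i)" by (simp add: power_add[symmetric])
      thus "ev1 p.x (coeff K i) * ((p.D z * ?GY) ^ i * ?GY ^ (e - i)) =
          ev1 p.x (coeff K i) * p.D z ^ i * ?GY ^ e" by (simp add: power_mult_distrib mult_ac)
    qed
    also have "(\<Sum>i\<le>e. ev1 p.x (coeff K i) * p.D z ^ i) = ev p.x (p.D z) K"
      unfolding e_def by (subst (2) poly_as_sum_of_monoms[of K, symmetric])
        (simp add: ev.hom_sum)
    finally show "ev p.x z Q = 0 \<longleftrightarrow> ev p.x (p.D z) K = 0" using GY by simp
  qed
qed

text \<open>The same \<open>Q\<close> serves at all expansion points: vanishing at the given
  \<open>y\<close>, it is a multiple of \<open>G\<close>, and so it vanishes at every root of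
  \<open>G\<close> anywhere, in particular at the conjugates at infinity.\<close>

lemma relation_transfer:
  assumes G: "Factorial_Ring.irreducible G" "ev x y G = 0" and K: "ev x (D y) K = 0"
    and n': "n' > 0" and z: "ev (puiseux_x pt' n') z G = 0"
  shows "ev (puiseux_x pt' n') (puiseux_deriv pt' n' z) K = 0"
proof -
  obtain Q where Q: "\<And>pt' n' z. n' > 0 \<Longrightarrow> ev (puiseux_x pt' n') z G = 0 \<Longrightarrow>
    (ev (puiseux_x pt' n') z Q = 0 \<longleftrightarrow> ev (puiseux_x pt' n') (puiseux_deriv pt' n' z) K = 0)"
    using relation_transfer_poly[OF G(1), of K] by blast
  have "G dvd Q" using Q[OF n_pos G(2)] K G by (intro irreducible_dvd_if_ev_eq_0[OF _ _ nonconstant_x]) auto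
  hence "ev (puiseux_x pt' n') z Q = 0" using z by (auto simp: dvd_def ev.hom_mult)
  thus ?thesis using Q[OF n' z] by simp
qed

text \<open>As \<open>x\<close> is transcendental, a constant root \<open>a\<close> makes
  \<open>Y - a\<close> a factor of the irreducible \<open>G\<close>; up to a unit they are then
  equal, and \<open>y = a\<close>.\<close>

lemma conjugate_nonconstant:
  assumes G: "Factorial_Ring.irreducible G" "ev x y G = 0" and y: "nonconstant y"
    and n': "n' > 0" and z: "ev (puiseux_x pt' n') z G = 0"
  shows "nonconstant z"
  unfolding nonconstant_def
proof (intro allI notI)
  fix a assume a: "z = fls_const a"
  interpret p: puiseux pt' n' using n' by unfold_locales
  have "poly G [:a:] = 0" using z ev1_eq_0_iff[OF p.nonconstant_x] by (simp add: a ev_fls_const)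
  then obtain T where T: "G = [:-[:a:], 1:] * T" by (auto simp: poly_eq_0_iff_dvd dvd_def)
  have "\<not> is_unit [:-[:a:], 1:]" by (auto simp: is_unit_poly_iff)
  hence "is_unit T" using Factorial_Ring.irreducibleD[OF G(1) T] by blast
  hence "ev x y T dvd 1" using ev.hom_dvd_1 by blast
  hence "ev x y T \<noteq> 0" by auto
  hence "ev x y [:-[:a:], 1:] = 0" using G(2) unfolding T ev.hom_mult by simp
  hence "y = fls_const a" by (simp add: fls_const.hom_uminus)
  thus False using y by (simp add: nonconstant_def)
qed

text \<open>If \<open>z\<close> and \<open>z + a\<close> are both roots of the irreducible \<open>G\<close>, then \<open>G\<close> is invariant under
  \<open>Y \<mapsto> Y + a\<close> and has the infinitely many roots \<open>z + k a\<close>.\<close>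
lemma conjugates_deriv_inj:
  assumes G: "Factorial_Ring.irreducible G" "ev x y G = 0" "ev x z G = 0" and eq: "D y = D z"
  shows "y = z"
proof -
  obtain a where a: "y = z + fls_const a" using deriv_eq_imp_diff_const[OF eq] by blast
  have shift: "ev x w (pcompose P [:[:c:], 1:]) = ev x (w + fls_const c) P" for w c P
    by (induction P) (simp_all add: pcompose_pCons ev.hom_add ev.hom_mult algebra_simps)
  define T where "T = pcompose G [:[:a:], 1:]"
  have "ev x z T = 0" using G(2) by (simp add: T_def shift a)
  hence "G dvd T" using G by (intro irreducible_dvd_if_ev_eq_0[OF _ _ nonconstant_x]) auto
  then obtain S where S: "T = G * S" by (auto simp: dvd_def)
  have G0: "G \<noteq> 0" using G by auto
  \<comment> \<open>The shift preserves the degree and the leading coefficient, which forces the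
    cofactor \<open>S\<close> to be 1.\<close>
  have dT: "degree T = degree G" by (simp add: T_def degree_pcompose)
  have lT: "lead_coeff T = lead_coeff G" 
    using lead_coeff_comp[of "[:[:a:], 1:]" G] by (simp add: T_def degree_pcompose)
  have S0: "S \<noteq> 0" using lT G0 S by auto
  hence "degree S = 0" using dT G0 unfolding S by (simp add: degree_mult_eq)
  moreover have "lead_coeff S = 1" using lT G0 unfolding S lead_coeff_mult by simp
  ultimately have "S = 1" by (metis degree_eq_zeroE lead_coeff_pCons(1) lead_coeff_1 one_pCons coeff_pCons_0)
  hence inv: "pcompose G [:[:a:], 1:] = G" using S by (simp add: T_def)
  have roots: "ev x (z + of_nat k * fls_const a) G = 0" for k
  proof (induction k)
    case (Suc k)
    have "ev x (z + of_nat k * fls_const a) (pcompose G [:[:a:], 1:]) = 0" using Suc by (simp add: inv)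
    thus ?case by (simp add: shift algebra_simps)
  qed (use G in simp)
  have "a = 0"
  proof (rule ccontr)
    assume "a \<noteq> 0"
    hence "inj (\<lambda>k :: nat. z + of_nat k * fls_const a)" by (auto simp: inj_on_def)
    hence "infinite (range (\<lambda>k :: nat. z + of_nat k * fls_const a))" by (rule range_inj_infinite)
    moreover have "map_poly (ev1 x) G \<noteq> 0"
    proof -
      have "ev1 x (lead_coeff G) \<noteq> 0" using G0 by (simp add: ev1_eq_0_iff[OF nonconstant_x])
      thus ?thesis by (metis coeff_0 coeff_map_poly ev1.hom_zero)
    qed
    hence "finite {w. poly (map_poly (ev1 x) G) w = 0}" by (rule poly_roots_finite)
    hence "finite (range (\<lambda>k :: nat. z + of_nat k * fls_const a))"
      by (rule finite_subset[rotated]) (use roots in \<open>auto simp: ev_def\<close>)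
    ultimately show False by simp
  qed
  thus ?thesis using a by simp
qed

end

section \<open>Orders at infinity, and the count of poles and zeros over all conjugates\<close>

declare puiseux_x.simps [simp del] puiseux_deriv.simps [simp del]

lemma fls_compose_power_ev1:
  "N > 0 \<Longrightarrow> fls_compose_power (ev1 b p) N = ev1 (fls_compose_power b N) p"
  by (induction p) simp_all

text \<open>At infinity \<open>x = t^-N\<close>, so the top term of a nonzero \<open>p\<close>
  dominates and the order is \<open>- N * degree p\<close>.\<close>

lemma ord_ge_ev1_x_infinity:
  assumes "N > 0"
  shows "ord_ge (- int (N * degree p)) (ev1 (puiseux_x At_infinity N) p)"
    and "fls_subdegree (ev1 (puiseux_x At_infinity N) p) \<le> 0"
proof -
  let ?x = "puiseux_x At_infinity N"
  have ev: "ev1 ?x p = (\<Sum>i\<le>degree p. fls_const (coeff p i) * fls_X_inv ^ (N * i))"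
    by (simp add: ev1_def poly_altdef power_mult coeff_map_poly puiseux_x.simps)
  show "ord_ge (- int (N * degree p)) (ev1 ?x p)"
    unfolding ev
  proof (rule ord_ge_sum)
    fix i assume "i \<in> {..degree p}"
    hence "- int (N * degree p) \<le> 0 + - int (N * i)" by (simp del: of_nat_mult)
    moreover have "ord_ge (0 + - int (N * i)) (fls_const (coeff p i) * fls_X_inv ^ (N * i))"
      by (rule ord_ge_mult) auto
    ultimately show "ord_ge (- int (N * degree p)) (fls_const (coeff p i) * fls_X_inv ^ (N * i))"
      by linarith
  qed
  show "fls_subdegree (ev1 ?x p) \<le> 0"
  proof (cases "p = 0")
    case False
    have "fls_nth (ev1 ?x p) (- int (N * degree p)) =
        (\<Sum>i\<le>degree p. if i = degree p then coeff p i else 0)"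
      unfolding ev fls_nth_sum using assms by (intro sum.cong) (auto simp: fls_X_inv_power_nth)
    also have "\<dots> \<noteq> 0" using False by simp
    finally have "fls_subdegree (ev1 ?x p) \<le> - int (N * degree p)" by (rule fls_subdegree_leI)
    thus ?thesis by (simp del: of_nat_mult)
  qed simp
qed

text \<open>Since dt/dx is \<open>- t^(N+1) / N\<close>, a pole of order \<open>k\<close> of
  \<open>z\<close> gives \<open>z'\<close> the order \<open>N - k\<close>. Without a pole,
  \<open>z'\<close> has order at least \<open>N + 1\<close>.\<close>

lemma order_conjugate_at_infinity:
  assumes "N > 0" "nonconstant z"
  shows "int N \<le> max 0 (- fls_subdegree z) + max 0 (fls_subdegree (puiseux_deriv At_infinity N z))"
proof -
  interpret puiseux At_infinity N using assms(1) by unfold_locales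
  have "fls_deriv z \<noteq> 0"
  proof
    assume "fls_deriv z = 0"
    hence "D z = 0" by (simp add: puiseux_deriv.simps)
    thus False using deriv_eq_0 assms(2) by (auto simp: nonconstant_def)
  qed
  hence D: "fls_subdegree (D z) = fls_subdegree (fls_deriv z) + int N + 1"
    using assms(1) by (simp add: fls_shift_eq0_iff puiseux_deriv.simps)
  show ?thesis
  proof (cases "fls_subdegree z < 0")
    case True
    thus ?thesis unfolding D by (simp add: fls_subdegree_deriv)
  next
    case False
    have "fls_subdegree (fls_deriv z) \<ge> 0"
      using False fls_subdegree_deriv[of z] fls_deriv_subdegree0[of z] by (cases "fls_subdegree z = 0") auto
    thus ?thesis unfolding D by simp
  qed
qed

context puiseux
begin

lemma outer_degree_minimal_polynomial_le:
  assumes G: "Factorial_Ring.irreducible G" "ev x y G = 0" and y: "nonconstant y"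
    and K: "K \<noteq> 0" "ev x (D y) K = 0"
  shows "outer_degree G \<le> inner_degree G + inner_degree K"
proof -
  obtain K' where K': "Factorial_Ring.irreducible K'" "K' dvd K" "ev x (D y) K' = 0"
    using ev_irreducible_factor[OF K] by blast
  have K'0: "K' \<noteq> 0" using K' by auto
  have Dy: "D y \<noteq> 0" using deriv_eq_0[of y] y by (auto simp: nonconstant_def)
  \<comment> \<open>This is the reason for passing to an irreducible factor: with vanishing constant
    coefficient, \<open>K'\<close> would be the outer variable up to a unit, and \<open>y'\<close>
    would be 0. \<open>sum_root_zeros_le\<close> relies on it.\<close>
  have const_coeff: "coeff K' 0 \<noteq> 0"
  proof
    assume *: "coeff K' 0 = 0"
    obtain a L where "K' = pCons a L" by (cases K')
    hence L: "K' = [:0, 1:] * L" using * by simp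
    have "\<not> is_unit ([:0, 1:] :: complex poly poly)" by (auto simp: is_unit_poly_iff)
    hence "is_unit L" using Factorial_Ring.irreducibleD[OF K'(1) L] by blast
    hence "ev x (D y) L dvd 1" using ev.hom_dvd_1 by blast
    hence "ev x (D y) L \<noteq> 0" by auto
    thus False using K'(3) Dy unfolding L ev.hom_mult by simp
  qed
  have lcG: "lead_coeff G \<noteq> 0" using G by auto
  \<comment> \<open>Here \<open>x\<close> is \<open>t^-1\<close>; the ramification by
    \<open>N\<close> turns it into \<open>p.x\<close>.\<close>
  define P where "P = map_poly (ev1 fls_X_inv) G"
  have "ev1 fls_X_inv (lead_coeff G) \<noteq> 0"
    using lcG puiseux.nonconstant_x[of 1 At_infinity] by (simp add: ev1_eq_0_iff puiseux_def puiseux_x.simps)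
  hence lP: "coeff P (degree G) \<noteq> 0" by (simp add: P_def coeff_map_poly)
  hence dP: "degree P = degree G" unfolding P_def by (intro antisym degree_map_poly_le le_degree)
  have "P \<noteq> 0" using lP by auto
  then obtain N zs where N: "N > 0" "length zs = degree P"
    "map_poly (\<lambda>c. fls_compose_power c N) P = smult (fls_compose_power (lead_coeff P) N) (\<Prod>z\<leftarrow>zs. [:-z, 1:])"
    using newton_puiseux by blast
  interpret p: puiseux At_infinity N using N(1) by unfold_locales
  have "fls_compose_power fls_X_inv N = p.x" using N(1)
    by (intro fls_eqI) (auto simp: fls_X_inv_power_nth puiseux_x.simps)
  hence map: "map_poly (\<lambda>c. fls_compose_power c N) P = map_poly (ev1 p.x) G"
    unfolding P_def using N(1) by (subst map_poly_map_poly) (auto simp: o_def fls_compose_power_ev1)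
  define c where "c = fls_compose_power (lead_coeff P) N"
  have c: "c = ev1 p.x (lead_coeff G)" using arg_cong[OF map, of "\<lambda>P. coeff P (degree G)"] dP N(1)
    by (simp add: c_def coeff_map_poly)
  have c0: "c \<noteq> 0" using lcG by (simp add: c ev1_eq_0_iff[OF p.nonconstant_x])
  have GN: "map_poly (ev1 p.x) G = [:c:] * (\<Prod>z\<leftarrow>zs. [:-z, 1:])"
    using N(3) map by (simp add: c_def)
  have root: "ev p.x z G = 0" if "z \<in> set zs" for z
  proof -
    have "[:-z, 1:] dvd (\<Prod>z\<leftarrow>zs. [:-z, 1:])" using that by (intro prod_list_dvd) auto
    hence "[:-z, 1:] dvd map_poly (ev1 p.x) G" unfolding GN by (rule dvd_mult)
    thus ?thesis by (simp add: ev_def poly_eq_0_iff_dvd)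
  qed
  \<comment> \<open>A repeated root would also be a root of \<open>pderiv G\<close>.\<close>
  have "distinct zs"
  proof (rule ccontr)
    assume "\<not> distinct zs"
    then obtain as bs cs z where zs: "zs = as @ [z] @ bs @ [z] @ cs"
      using not_distinct_decomp by blast
    define R where "R = [:c:] * ((\<Prod>z\<leftarrow>as. [:-z, 1:]) * (\<Prod>z\<leftarrow>bs. [:-z, 1:]) * (\<Prod>z\<leftarrow>cs. [:-z, 1:]))"
    have "map_poly (ev1 p.x) G = [:-z, 1:] * ([:-z, 1:] * R)"
      unfolding GN zs R_def by (simp only: map_append prod_list.append list.map prod_list.Cons prod_list.Nil mult_1_right mult_1_left mult_ac)
    hence "poly (pderiv (map_poly (ev1 p.x) G)) z = 0" by (simp add: pderiv_mult pderiv_pCons del: mult_pCons_left)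
    hence "ev p.x z (pderiv G) = 0" by (simp add: ev_def ev1.map_poly_pderiv)
    thus False using p.pderiv_irreducible_nonzero[OF G(1) root p.nonconstant_x] zs by auto
  qed
  define ws where "ws = map p.D zs"
  have "distinct ws"
    unfolding ws_def distinct_map
  proof (intro conjI inj_onI)
    fix z z' assume "z \<in> set zs" "z' \<in> set zs" "p.D z = p.D z'"
    thus "z = z'" using p.conjugates_deriv_inj[OF G(1) root root] by metis
  qed fact
  have nonconst: "nonconstant z" if "z \<in> set zs" for z
    using conjugate_nonconstant[OF G y N(1)] root[OF that] by blast
  \<comment> \<open>The relation for \<open>y'\<close> passes to the derivatives of all conjugates;
    being distinct, these split off from \<open>K'\<close> together.\<close>
  have "poly (map_poly (ev1 p.x) K') w = 0" if "w \<in> set ws" for w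
    using that relation_transfer[OF G K'(3) N(1)] root by (auto simp: ws_def ev_def)
  then obtain Q where Q: "map_poly (ev1 p.x) K' = Q * (\<Prod>w\<leftarrow>ws. [:-w, 1:])"
    using distinct_roots_prod_dvd[OF \<open>distinct ws\<close>, of "map_poly (ev1 p.x) K'"]
    by (auto simp: dvd_def mult.commute)
  have ord: "ord_ge (- int (N * inner_degree L)) (coeff (map_poly (ev1 p.x) L) i)" for L i
  proof -
    have "- int (N * inner_degree L) \<le> - int (N * degree (coeff L i))"
      using degree_coeff_le_inner_degree[of L i] by (simp add: mult_left_mono)
    thus ?thesis using ord_ge_ev1_x_infinity(1)[OF N(1), of "coeff L i"]
      by (auto simp: coeff_map_poly)
  qed
  have "(\<Sum>z\<leftarrow>zs. max 0 (- fls_subdegree z)) \<le> int (N * inner_degree G)"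
    using ord[of G] c0 c ord_ge_ev1_x_infinity(2)[OF N(1), of "lead_coeff G"] unfolding GN
    by (intro sum_root_poles_le[where Q = "[:c:]"]) auto
  moreover have "(\<Sum>w\<leftarrow>ws. max 0 (fls_subdegree w)) \<le> int (N * inner_degree K')"
    using ord[of K'] const_coeff ord_ge_ev1_x_infinity(2)[OF N(1), of "coeff K' 0"]
    by (intro sum_root_zeros_le[OF _ Q]) (auto simp: coeff_map_poly ev1_eq_0_iff[OF p.nonconstant_x])
  moreover have "int N * int (length zs) \<le>
      (\<Sum>z\<leftarrow>zs. max 0 (- fls_subdegree z)) + (\<Sum>w\<leftarrow>ws. max 0 (fls_subdegree w))"
    using nonconst unfolding ws_def
  proof (induction zs)
    case (Cons z zs)
    thus ?case using order_conjugate_at_infinity[OF N(1), of z]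
      by (simp add: algebra_simps)
  qed simp
  ultimately have "int N * int (degree G) \<le> int N * int (inner_degree G + inner_degree K')"
    using N(2) dP by (simp add: algebra_simps)
  hence "degree G \<le> inner_degree G + inner_degree K'" using N(1) by simp
  also have "inner_degree K' \<le> inner_degree K" by (rule inner_degree_dvd[OF K'(2) K(1)])
  finally show ?thesis by (simp add: outer_degree_def)
qed

theorem minimal_polynomial_degree_bounds:
  assumes y: "nonconstant y" and Dy: "nonconstant (D y)"
    and F: "Factorial_Ring.irreducible F" "ev y (D y) F = 0"
    and G: "Factorial_Ring.irreducible G" "ev x y G = 0"
  shows "inner_degree G \<le> outer_degree F"
    and "outer_degree G \<le> inner_degree F + outer_degree F"
proof -
  show i: "inner_degree G \<le> outer_degree F"
    by (rule inner_degree_minimal_polynomial_le[OF y F G])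
  have "G \<noteq> 0" using G by auto
  then obtain K where K: "K \<noteq> 0" "ev x (D y) K = 0" "inner_degree K \<le> inner_degree F"
    using relation_x_deriv[OF y F _ G(2) Dy] by blast
  have "outer_degree G \<le> inner_degree G + inner_degree K"
    by (rule outer_degree_minimal_polynomial_le[OF G y K(1,2)])
  thus "outer_degree G \<le> inner_degree F + outer_degree F" using i K(3) by simp
qed

end

subsection \<open>Evaluation of differential polynomials\<close>

definition mono_eval :: "(nat \<Rightarrow> 'a::comm_ring_1) \<Rightarrow> (nat \<Rightarrow>\<^sub>0 nat) \<Rightarrow> 'a" where
  "mono_eval a k = (\<Prod>i\<in>Poly_Mapping.keys k. a i ^ Poly_Mapping.lookup k i)"

lemma mono_eval_superset:
  assumes "finite I" "Poly_Mapping.keys k \<subseteq> I"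
  shows "mono_eval a k = (\<Prod>i\<in>I. a i ^ Poly_Mapping.lookup k i)"
  unfolding mono_eval_def using assms by (intro prod.mono_neutral_left) (auto simp: in_keys_iff)

lemma mono_eval_add: "mono_eval a (k + l) = mono_eval a k * mono_eval a l"
proof -
  let ?I = "Poly_Mapping.keys k \<union> Poly_Mapping.keys l"
  have "mono_eval a (k + l) = (\<Prod>i\<in>?I. a i ^ Poly_Mapping.lookup (k + l) i)"
    by (intro mono_eval_superset) (auto dest: keys_add[THEN subsetD])
  also have "\<dots> = (\<Prod>i\<in>?I. a i ^ Poly_Mapping.lookup k i) * (\<Prod>i\<in>?I. a i ^ Poly_Mapping.lookup l i)"
    by (simp add: lookup_add power_add prod.distrib)
  finally show ?thesis by (simp add: mono_eval_superset[of ?I])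
qed

lemma mono_eval_0 [simp]: "mono_eval a 0 = 1"
  by (simp add: mono_eval_def)

lemma poly_mapping_eq_sum_single:
  "p = (\<Sum>k\<in>Poly_Mapping.keys p. Poly_Mapping.single k (Poly_Mapping.lookup p k))"
  by (rule poly_mapping_eqI) (simp add: lookup_sum lookup_single when_def in_keys_iff)

context
  fixes \<iota> :: "complex \<Rightarrow> 'a::comm_ring_1"
  assumes \<iota>: "comm_ring_hom \<iota>"
begin

interpretation \<iota>: comm_ring_hom \<iota> by (fact \<iota>)

lemma mp_eval_superset:
  assumes "finite I" "Poly_Mapping.keys p \<subseteq> I"
  shows "mp_eval \<iota> a p = (\<Sum>k\<in>I. \<iota> (Poly_Mapping.lookup p k) * mono_eval a k)"
  unfolding mp_eval_def mono_eval_def using assms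
  by (intro sum.mono_neutral_left) (auto simp: in_keys_iff)

lemma mp_eval_add: "mp_eval \<iota> a (p + q) = mp_eval \<iota> a p + mp_eval \<iota> a q"
proof -
  let ?I = "Poly_Mapping.keys p \<union> Poly_Mapping.keys q"
  have "mp_eval \<iota> a (p + q) = (\<Sum>k\<in>?I. \<iota> (Poly_Mapping.lookup (p + q) k) * mono_eval a k)"
    by (intro mp_eval_superset) (auto dest: keys_add[THEN subsetD])
  also have "\<dots> = (\<Sum>k\<in>?I. \<iota> (Poly_Mapping.lookup p k) * mono_eval a k) +
      (\<Sum>k\<in>?I. \<iota> (Poly_Mapping.lookup q k) * mono_eval a k)"
    by (simp add: lookup_add \<iota>.hom_add distrib_right sum.distrib)
  finally show ?thesis by (simp add: mp_eval_superset[of ?I])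
qed

lemma mp_eval_0 [simp]: "mp_eval \<iota> a 0 = 0"
  by (simp add: mp_eval_def)

lemma mp_eval_sum: "mp_eval \<iota> a (\<Sum>i\<in>A. f i) = (\<Sum>i\<in>A. mp_eval \<iota> a (f i))"
  by (induction A rule: infinite_finite_induct) (simp_all add: mp_eval_add)

lemma mp_eval_single: "mp_eval \<iota> a (Poly_Mapping.single k c) = \<iota> c * mono_eval a k"
  by (simp add: mp_eval_superset[of "{k}"])

lemma mp_eval_mult: "mp_eval \<iota> a (p * q) = mp_eval \<iota> a p * mp_eval \<iota> a q"
proof -
  let ?S = "\<lambda>p. (\<Sum>k\<in>Poly_Mapping.keys p. Poly_Mapping.single k (Poly_Mapping.lookup p k))"
  have "mp_eval \<iota> a (?S p * ?S q) = mp_eval \<iota> a (?S p) * mp_eval \<iota> a (?S q)"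
    unfolding sum_product mp_eval_sum
    by (intro sum.cong refl) (simp add: mult_single mp_eval_single mono_eval_add \<iota>.hom_mult mult_ac)
  thus ?thesis by (simp add: poly_mapping_eq_sum_single[symmetric])
qed

lemma mp_eval_const [simp]: "mp_eval \<iota> a (mp_const c) = \<iota> c"
  by (simp add: mp_const_def mp_eval_single)

lemma mp_eval_var [simp]: "mp_eval \<iota> a (mp_var i) = a i"
  by (simp add: mp_var_def mp_eval_single mono_eval_def)

lemma mp_eval_1 [simp]: "mp_eval \<iota> a 1 = 1"
  using mp_eval_const[of a 1] by (simp add: mp_const_def)

lemma comm_ring_hom_mp_eval: "comm_ring_hom (mp_eval \<iota> a)"
  by unfold_locales (simp_all add: mp_eval_add mp_eval_mult)

end

lemma mp_eval_cong:
  assumes "\<And>i. i \<in> mp_vars p \<Longrightarrow> a i = b i"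
  shows "mp_eval \<iota> a p = mp_eval \<iota> b p"
proof -
  have "a i = b i" if "k \<in> Poly_Mapping.keys p" "i \<in> Poly_Mapping.keys k" for k i
    using that by (intro assms) (auto simp: mp_vars_def)
  thus ?thesis unfolding mp_eval_def by simp
qed

lemma mp_const_add: "mp_const (a + b) = mp_const a + mp_const b"
  by (simp add: mp_const_def single_add)

lemma mp_const_mult: "mp_const (a * b) = mp_const a * mp_const b"
  by (simp add: mp_const_def mult_single)

lemma mp_const_0 [simp]: "mp_const 0 = 0" by (simp add: mp_const_def)
lemma mp_const_1 [simp]: "mp_const 1 = 1" by (simp add: mp_const_def)

interpretation mp_const: comm_ring_hom mp_const
  by unfold_locales (simp_all add: mp_const_add mp_const_mult)

lemma mp_vars_add: "mp_vars (p + q) \<subseteq> mp_vars p \<union> mp_vars q"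
  unfolding mp_vars_def using keys_add[of p q] by blast

lemma mp_vars_mult: "mp_vars (p * q) \<subseteq> mp_vars p \<union> mp_vars q"
proof
  fix i assume "i \<in> mp_vars (p * q)"
  then obtain k where k: "k \<in> Poly_Mapping.keys (p * q)" "i \<in> Poly_Mapping.keys k"
    by (auto simp: mp_vars_def)
  then obtain a b where ab: "k = a + b" "a \<in> Poly_Mapping.keys p" "b \<in> Poly_Mapping.keys q"
    using keys_mult[of p q] by blast
  have "i \<in> Poly_Mapping.keys a \<union> Poly_Mapping.keys b" using k(2) keys_add[of a b] ab(1) by blast
  thus "i \<in> mp_vars p \<union> mp_vars q" using ab by (auto simp: mp_vars_def)
qed

lemma mp_vars_const [simp]: "mp_vars (mp_const c) = {}"
  by (simp add: mp_vars_def mp_const_def)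

lemma mp_vars_0 [simp]: "mp_vars 0 = {}" and mp_vars_1 [simp]: "mp_vars 1 = {}"
  by (simp_all add: mp_vars_def)

lemma mp_vars_var [simp]: "mp_vars (mp_var i) = {i}"
  by (simp add: mp_vars_def mp_var_def)

lemma finite_mp_vars [simp]: "finite (mp_vars p)"
  by (simp add: mp_vars_def)

lemma mp_vars_sum: "mp_vars (\<Sum>i\<in>A. f i) \<subseteq> (\<Union>i\<in>A. mp_vars (f i))"
  by (induction A rule: infinite_finite_induct) (use mp_vars_add in fastforce)+

lemma single_eq_mono: "Poly_Mapping.single k c = mp_const c * mono_eval mp_var k"
proof (induction k rule: update_induct)
  have pow: "mp_var i ^ n = Poly_Mapping.single (Poly_Mapping.single i n) 1" for i n
    by (induction n) (simp_all add: mp_var_def mult_single single_add[symmetric])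
  fix k :: "nat \<Rightarrow>\<^sub>0 nat" and i n :: nat
  assume k: "i \<notin> Poly_Mapping.keys k" "n \<noteq> 0"
    and IH: "Poly_Mapping.single k c = mp_const c * mono_eval mp_var k"
  have "Poly_Mapping.update i n k = Poly_Mapping.single i n + k"
  proof (rule poly_mapping_eqI)
    fix j show "Poly_Mapping.lookup (Poly_Mapping.update i n k) j =
        Poly_Mapping.lookup (Poly_Mapping.single i n + k) j"
      using k by (cases "j = i") (auto simp: lookup_update lookup_add lookup_single in_keys_iff)
  qed
  hence "Poly_Mapping.single (Poly_Mapping.update i n k) c =
      Poly_Mapping.single (Poly_Mapping.single i n) 1 * Poly_Mapping.single k c"
    by (simp add: mult_single)
  also have "\<dots> = mp_const c * mono_eval mp_var (Poly_Mapping.update i n k)"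
    using k \<open>Poly_Mapping.update i n k = _\<close> unfolding IH pow[symmetric]
    by (simp add: mono_eval_add) (simp add: mono_eval_def mult_ac)
  finally show "Poly_Mapping.single (Poly_Mapping.update i n k) c =
    mp_const c * mono_eval mp_var (Poly_Mapping.update i n k)" .
qed (simp add: mp_const_def)

text \<open>Constants and the variables in \<open>V\<close> generate these polynomials, so
  identities between homomorphisms or derivations need a check on generators only.\<close>

lemma dpoly_induct [consumes 1, case_names const var add mult]:
  assumes "mp_vars p \<subseteq> V"
    and const: "\<And>c. P (mp_const c)" and var: "\<And>i. i \<in> V \<Longrightarrow> P (mp_var i)"
    and add: "\<And>p q. mp_vars p \<subseteq> V \<Longrightarrow> mp_vars q \<subseteq> V \<Longrightarrow> P p \<Longrightarrow> P q \<Longrightarrow> P (p + q)"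
    and mult: "\<And>p q. mp_vars p \<subseteq> V \<Longrightarrow> mp_vars q \<subseteq> V \<Longrightarrow> P p \<Longrightarrow> P q \<Longrightarrow> P (p * q)"
  shows "P p"
proof -
  \<comment> \<open>The bound on the variables is carried along because the cases for sums and
    products may assume it.\<close>
  define Q where "Q p \<longleftrightarrow> mp_vars p \<subseteq> V \<and> P p" for p
  have Qc: "Q (mp_const c)" for c using const by (simp add: Q_def)
  have Qv: "Q (mp_var i)" if "i \<in> V" for i using var that by (simp add: Q_def)
  have Qa: "Q (p + q)" if "Q p" "Q q" for p q
    using that add mp_vars_add[of p q] by (auto simp: Q_def)
  have Qm: "Q (p * q)" if "Q p" "Q q" for p q
    using that mult mp_vars_mult[of p q] by (auto simp: Q_def)
  have Q1: "Q 1" and Q0: "Q 0" using Qc[of 1] Qc[of 0] by simp_all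
  have Qp: "Q (p ^ n)" if "Q p" for p n
    by (induction n) (use that Q1 Qm in auto)
  have Qmono: "Q (mono_eval mp_var k)" if "Poly_Mapping.keys k \<subseteq> V" for k
  proof -
    have "Q (\<Prod>i\<in>I. mp_var i ^ Poly_Mapping.lookup k i)" if "I \<subseteq> V" for I
      using that by (induction I rule: infinite_finite_induct) (auto intro: Q1 Qm Qp Qv)
    thus ?thesis unfolding mono_eval_def using that by blast
  qed
  have "Q (\<Sum>k\<in>I. Poly_Mapping.single k (Poly_Mapping.lookup p k))" if "I \<subseteq> Poly_Mapping.keys p" for I
    using that
  proof (induction I rule: infinite_finite_induct)
    case (insert k I)
    have "Poly_Mapping.keys k \<subseteq> V" using insert.prems assms(1) by (auto simp: mp_vars_def)
    thus ?case using insert by (simp add: single_eq_mono Qa Qm Qc Qmono)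
  qed (use Q0 in auto)
  hence "Q (\<Sum>k\<in>Poly_Mapping.keys p. Poly_Mapping.single k (Poly_Mapping.lookup p k))" by blast
  thus ?thesis by (simp add: poly_mapping_eq_sum_single[symmetric] Q_def)
qed

subsection \<open>Partial and total derivatives\<close>

interpretation mp_const_poly: comm_ring_hom "\<lambda>c. [:mp_const c:]"
  by unfold_locales (simp_all add: mp_const_add mp_const_mult one_pCons mult.commute)

interpretation mp_upoly: comm_ring_hom "mp_upoly i"
  unfolding mp_upoly_def by (rule comm_ring_hom_mp_eval) (rule mp_const_poly.comm_ring_hom_axioms)

lemma mp_upoly_const [simp]: "mp_upoly i (mp_const c) = [:mp_const c:]"
  unfolding mp_upoly_def by (rule mp_eval_const) (rule mp_const_poly.comm_ring_hom_axioms)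

lemma mp_upoly_var [simp]: "mp_upoly i (mp_var j) = (if j = i then [:0, 1:] else [:mp_var j:])"
  unfolding mp_upoly_def by (rule mp_eval_var) (rule mp_const_poly.comm_ring_hom_axioms)

lemma poly_mp_upoly: "poly (mp_upoly i p) (mp_var i) = p"
  by (induction p rule: dpoly_induct[OF subset_UNIV]) (auto simp: mp_upoly.hom_add mp_upoly.hom_mult)

lemma mp_pderiv_const [simp]: "mp_pderiv i (mp_const c) = 0"
  by (simp add: mp_pderiv_def pderiv_pCons)

lemma mp_pderiv_var [simp]: "mp_pderiv i (mp_var j) = (if j = i then 1 else 0)"
  by (simp add: mp_pderiv_def pderiv_pCons)

lemma mp_pderiv_add: "mp_pderiv i (p + q) = mp_pderiv i p + mp_pderiv i q"
  by (simp add: mp_pderiv_def mp_upoly.hom_add pderiv_add)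

lemma mp_pderiv_mult: "mp_pderiv i (p * q) = mp_pderiv i p * q + p * mp_pderiv i q"
  by (simp add: mp_pderiv_def mp_upoly.hom_mult pderiv_mult poly_mp_upoly algebra_simps)

lemma mp_vars_pderiv: "mp_vars (mp_pderiv i p) \<subseteq> mp_vars p"
proof -
  have "mp_vars (mp_pderiv i q) \<subseteq> V" if "mp_vars q \<subseteq> V" for q V
    using that
  proof (induction q rule: dpoly_induct)
    case (add p q)
    thus ?case using mp_vars_add unfolding mp_pderiv_add by blast
  next
    case (mult p q)
    thus ?case using mp_vars_add mp_vars_mult unfolding mp_pderiv_mult by (meson le_sup_iff order.trans)
  qed auto
  thus ?thesis by blast
qed

lemma mp_pderiv_eq_0:
  assumes "i \<notin> mp_vars p" shows "mp_pderiv i p = 0"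
proof -
  have "mp_vars p \<subseteq> - {i}" using assms by auto
  thus ?thesis by (induction p rule: dpoly_induct) (auto simp: mp_pderiv_add mp_pderiv_mult)
qed

lemma total_deriv_superset:
  assumes "finite I" "mp_vars p \<subseteq> I"
  shows "total_deriv p = (\<Sum>i\<in>I. mp_pderiv i p * mp_var (Suc i))"
  unfolding total_deriv_def using assms by (intro sum.mono_neutral_left) (auto simp: mp_pderiv_eq_0)

lemma total_deriv_const [simp]: "total_deriv (mp_const c) = 0"
  by (simp add: total_deriv_def)

lemma total_deriv_var [simp]: "total_deriv (mp_var i) = mp_var (Suc i)"
  by (simp add: total_deriv_def)

lemma total_deriv_add: "total_deriv (p + q) = total_deriv p + total_deriv q"
  using mp_vars_add[of p q]
  by (simp add: total_deriv_superset[of "mp_vars p \<union> mp_vars q"] mp_pderiv_add distrib_right sum.distrib)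

lemma total_deriv_mult: "total_deriv (p * q) = total_deriv p * q + p * total_deriv q"
  using mp_vars_mult[of p q]
  by (simp add: total_deriv_superset[of "mp_vars p \<union> mp_vars q"] mp_pderiv_mult algebra_simps
      sum.distrib sum_distrib_left)

lemma mp_vars_total_deriv:
  assumes "mp_vars p \<subseteq> {..k}" shows "mp_vars (total_deriv p) \<subseteq> {..Suc k}"
proof -
  have "mp_vars (mp_pderiv i p * mp_var (Suc i)) \<subseteq> {..Suc k}" if "i \<in> mp_vars p" for i
    using mp_vars_mult[of "mp_pderiv i p" "mp_var (Suc i)"] mp_vars_pderiv[of i p] that assms by force
  hence "(\<Union>i\<in>mp_vars p. mp_vars (mp_pderiv i p * mp_var (Suc i))) \<subseteq> {..Suc k}"
    by (rule UN_least)
  thus ?thesis unfolding total_deriv_def by (rule order.trans[OF mp_vars_sum])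
qed

lemma total_deriv_pow_rest:
  "(total_deriv ^^ k) G = mp_pderiv 1 G * mp_var (Suc k) + deriv_rest G k"
  by (simp add: deriv_rest_def)

text \<open>Differentiating \<open>S u_(k+2) + R\<close> gives
  \<open>S u_(k+3) + S' u_(k+2) + R'\<close>: the new top variable occurs only with the coefficient
  \<open>S\<close>, and the rest stays below it.\<close>

lemma mp_vars_deriv_rest:
  assumes "mp_vars G \<subseteq> {..1}"
  shows "mp_vars (deriv_rest G (Suc k)) \<subseteq> {..Suc k}"
proof (induction k)
  case 0
  have "total_deriv G = mp_pderiv 0 G * mp_var 1 + mp_pderiv 1 G * mp_var 2"
    using assms by (subst total_deriv_superset[of "{..1}"]) (auto simp: atMost_Suc numeral_2_eq_2)
  hence "deriv_rest G (Suc 0) = mp_pderiv 0 G * mp_var 1"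
    by (simp add: deriv_rest_def numeral_2_eq_2)
  thus ?case using mp_vars_mult[of "mp_pderiv 0 G" "mp_var 1"] mp_vars_pderiv[of 0 G] assms by auto
next
  case (Suc k)
  let ?S = "mp_pderiv 1 G"
  have "(total_deriv ^^ Suc (Suc k)) G = total_deriv (?S * mp_var (Suc (Suc k)) + deriv_rest G (Suc k))"
    by (simp only: total_deriv_pow_rest[symmetric] funpow.simps o_apply)
  hence eq: "deriv_rest G (Suc (Suc k)) = total_deriv ?S * mp_var (Suc (Suc k)) + total_deriv (deriv_rest G (Suc k))"
    unfolding deriv_rest_def[of G "Suc (Suc k)"] total_deriv_add total_deriv_mult total_deriv_var by simp
  have "mp_vars ?S \<subseteq> {..1}" using mp_vars_pderiv assms by (rule order.trans)
  hence "mp_vars (total_deriv ?S) \<subseteq> {..Suc 1}" by (rule mp_vars_total_deriv)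
  hence S: "mp_vars (total_deriv ?S) \<subseteq> {..Suc (Suc k)}" by (rule order.trans) auto
  have "mp_vars (total_deriv ?S * mp_var (Suc (Suc k))) \<subseteq> {..Suc (Suc k)}"
    by (rule order.trans[OF mp_vars_mult]) (use S in simp)
  hence "mp_vars (total_deriv ?S * mp_var (Suc (Suc k))) \<union>
      mp_vars (total_deriv (deriv_rest G (Suc k))) \<subseteq> {..Suc (Suc k)}"
    using mp_vars_total_deriv[OF Suc] by (rule Un_least)
  thus ?case unfolding eq by (rule order.trans[OF mp_vars_add])
qed

context puiseux
begin

text \<open>Both sides obey the sum and product rules and agree on constants and variables.\<close>

lemma deriv_mp_eval:
  "D (mp_eval fls_const (\<lambda>i. (D ^^ i) y) p) = mp_eval fls_const (\<lambda>i. (D ^^ i) y) (total_deriv p)"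
proof -
  interpret e: comm_ring_hom "mp_eval fls_const (\<lambda>i. (D ^^ i) y)"
    by (rule comm_ring_hom_mp_eval) (rule fls_const.comm_ring_hom_axioms)
  note [simp] = mp_eval_const[OF fls_const.comm_ring_hom_axioms] mp_eval_var[OF fls_const.comm_ring_hom_axioms]
  show ?thesis
    by (induction p rule: dpoly_induct[OF subset_UNIV])
       (simp_all add: total_deriv_add total_deriv_mult deriv_add deriv_mult e.hom_add e.hom_mult)
qed

end

subsection \<open>Polynomials in the first two variables\<close>

interpretation bivariate_const: comm_ring_hom "\<lambda>c. [:[:c:]:] :: complex poly poly"
  by unfold_locales (simp_all add: pCons_one)

interpretation to_bivariate: comm_ring_hom to_bivariate
  unfolding to_bivariate_def by (rule comm_ring_hom_mp_eval) (rule bivariate_const.comm_ring_hom_axioms)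

lemma to_bivariate_const [simp]: "to_bivariate (mp_const c) = [:[:c:]:]"
  unfolding to_bivariate_def by (rule mp_eval_const) (rule bivariate_const.comm_ring_hom_axioms)

lemma to_bivariate_var [simp]: "to_bivariate (mp_var i) =
    (if i = 0 then [:[:0, 1:]:] else if i = 1 then [:0, 1:] else 0)"
  unfolding to_bivariate_def by (rule mp_eval_var) (rule bivariate_const.comm_ring_hom_axioms)

lemma le_1_cases: "(i :: nat) \<in> {..1} \<Longrightarrow> i = 0 \<or> i = 1"
  by auto

lemma ev_to_bivariate:
  assumes "mp_vars p \<subseteq> {..1}"
  shows "ev (a 0) (a 1) (to_bivariate p) = mp_eval fls_const a p"
proof -
  interpret e: comm_ring_hom "mp_eval fls_const a"
    by (rule comm_ring_hom_mp_eval) (rule fls_const.comm_ring_hom_axioms)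
  note [simp] = mp_eval_const[OF fls_const.comm_ring_hom_axioms] mp_eval_var[OF fls_const.comm_ring_hom_axioms]
  show ?thesis using assms
  proof (induction p rule: dpoly_induct)
    case (var i)
    thus ?case using le_1_cases[of i] by auto
  qed (simp_all add: to_bivariate.hom_add to_bivariate.hom_mult ev.hom_add ev.hom_mult e.hom_add e.hom_mult)
qed

lemma to_bivariate_pderiv:
  "to_bivariate (mp_pderiv 1 p) = pderiv (to_bivariate p)"
  by (induction p rule: dpoly_induct[OF subset_UNIV])
     (auto simp: mp_pderiv_add mp_pderiv_mult to_bivariate.hom_add to_bivariate.hom_mult
       pderiv_add pderiv_mult pderiv_pCons)

lemma to_bivariate_eq_0:
  assumes "mp_vars p \<subseteq> {..1}" "to_bivariate p = 0" shows "p = 0"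
proof -
  \<comment> \<open>Together with \<open>r\<close> this builds a left inverse of
    \<open>to_bivariate\<close> on the polynomials in \<open>u_0\<close> and
    \<open>u_1\<close>.\<close>
  define r1 where "r1 q = poly (map_poly mp_const q) (mp_var 0)" for q
  define r where "r P = poly (map_poly r1 P) (mp_var 1)" for P
  interpret c: map_poly_comm_ring_hom mp_const ..
  interpret r1: comm_ring_hom r1
    unfolding r1_def by unfold_locales (simp_all add: c.hom_add c.hom_mult)
  interpret r1p: map_poly_comm_ring_hom r1 ..
  interpret r: comm_ring_hom r
    unfolding r_def by unfold_locales (simp_all add: r1p.hom_add r1p.hom_mult)
  have [simp]: "r1 (pCons a q) = mp_const a + mp_var 0 * r1 q" for a q
    by (simp add: r1_def mp_const.map_poly_pCons_hom)
  have [simp]: "r (pCons a q) = r1 a + mp_var 1 * r q" for a q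
    by (simp add: r_def r1.map_poly_pCons_hom)
  have "r (to_bivariate p) = p" using assms(1)
  proof (induction p rule: dpoly_induct)
    case (var i)
    thus ?case using le_1_cases[of i] by auto
  qed (simp_all add: to_bivariate.hom_add to_bivariate.hom_mult r.hom_add r.hom_mult)
  thus ?thesis using assms(2) by simp
qed

lemma to_bivariate_univariate:
  assumes "mp_vars p \<subseteq> {0}" shows "degree (to_bivariate p) = 0"
  using assms
proof (induction p rule: dpoly_induct)
  case (add p q)
  thus ?case unfolding to_bivariate.hom_add using degree_add_le[of "to_bivariate p" 0] by simp
next
  case (mult p q)
  thus ?case unfolding to_bivariate.hom_mult using degree_mult_le[of "to_bivariate p"] by (metis add_0 le_zero_eq)
qed auto

lemma complex_poly_poly_squarefree_nonzero:
  "squarefree (P :: complex poly poly) \<Longrightarrow> P \<noteq> 0"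
  unfolding squarefree_def by (metis dvd_0_right not_is_unit_0)

context puiseux
begin

text \<open>Let \<open>P = F * R\<close> with an irreducible \<open>F\<close> vanishing at the
  point. There \<open>pderiv P\<close> equals \<open>pderiv F * R\<close>, so its vanishing would
  give \<open>F dvd R\<close> and a square factor of \<open>P\<close>.\<close>

lemma ev_pderiv_squarefree_nonzero:
  assumes P: "squarefree P" "ev b c P = 0" and b: "nonconstant b"
  shows "ev b c (pderiv P) \<noteq> 0"
proof
  assume *: "ev b c (pderiv P) = 0"
  obtain F where F: "Factorial_Ring.irreducible F" "F dvd P" "ev b c F = 0"
    using ev_irreducible_factor[OF complex_poly_poly_squarefree_nonzero[OF P(1)] P(2)] by blast
  obtain R where R: "P = F * R" using F(2) by (auto simp: dvd_def)
  have "ev b c (pderiv F) * ev b c R = 0"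
    using * F(3) unfolding R pderiv_mult by (auto simp: ev.hom_add ev.hom_mult)
  hence "ev b c R = 0" using pderiv_irreducible_nonzero[OF F(1,3) b] by auto
  hence "F dvd R" using irreducible_dvd_if_ev_eq_0[OF F(1,3) b] by blast
  hence "F ^ 2 dvd P" unfolding R power2_eq_square by (intro mult_dvd_mono) auto
  hence "is_unit F" using P(1) by (simp add: squarefree_def)
  thus False using F(1) by (simp add: Factorial_Ring.irreducible_def)
qed

text \<open>If \<open>y' = a\<close>, then \<open>u_1 - a\<close> divides \<open>P\<close> because
  \<open>y\<close> is transcendental, and this is an excluded factor in \<complex>[u_1].\<close>

lemma nonconstant_deriv:
  assumes P: "ev y (D y) P = 0" and y: "nonconstant y"
    and no_factor: "\<forall>b :: complex poly. map_poly (\<lambda>c. [:c:]) b dvd P \<longrightarrow> degree b = 0"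
  shows "nonconstant (D y)"
  unfolding nonconstant_def
proof (intro allI notI)
  fix a assume a: "D y = fls_const a"
  have "poly P [:a:] = 0" using P ev1_eq_0_iff[OF y] by (simp add: a ev_fls_const)
  hence "[:-[:a:], 1:] dvd P" by (simp add: poly_eq_0_iff_dvd)
  also have "[:-[:a:], 1:] = map_poly (\<lambda>c. [:c:]) [:-a, 1:]"
    by (simp add: Polynomial.map_poly_pCons pCons_one)
  finally show False using no_factor[rule_format, of "[:-a, 1:]"] by simp
qed

end

subsection \<open>Evaluating fractions\<close>

text \<open>A relation rather than a function, since a fraction whose denominators vanish at
  \<open>(b, c)\<close> has no value. The representation \<open>A / B\<close> need not be in lowest
  terms.\<close>

definition fract_value :: "complex fls \<Rightarrow> complex fls \<Rightarrow> complex poly poly fract \<Rightarrow> complex fls \<Rightarrow> bool" where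
  "fract_value b c q v \<longleftrightarrow>
     (\<exists>A B. ev b c B \<noteq> 0 \<and> q * to_fract B = to_fract A \<and> v * ev b c B = ev b c A)"

lemma fract_valueI:
  "ev b c B \<noteq> 0 \<Longrightarrow> q * to_fract B = to_fract A \<Longrightarrow> v * ev b c B = ev b c A \<Longrightarrow> fract_value b c q v"
  unfolding fract_value_def by blast

lemma fract_value_to_fract: "fract_value b c (to_fract A) (ev b c A)"
  by (rule fract_valueI[of _ _ 1 _ A]) auto

lemma fract_value_add:
  assumes "fract_value b c q v" "fract_value b c r w"
  shows "fract_value b c (q + r) (v + w)"
proof -
  obtain A B A' B' where AB: "ev b c B \<noteq> 0" "q * to_fract B = to_fract A" "v * ev b c B = ev b c A"
    "ev b c B' \<noteq> 0" "r * to_fract B' = to_fract A'" "w * ev b c B' = ev b c A'"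
    using assms unfolding fract_value_def by blast
  show ?thesis
  proof (rule fract_valueI)
    show "ev b c (B * B') \<noteq> 0" using AB by (simp add: ev.hom_mult)
    have "(q + r) * to_fract (B * B') = (q * to_fract B) * to_fract B' + (r * to_fract B') * to_fract B"
      by (simp add: algebra_simps)
    thus "(q + r) * to_fract (B * B') = to_fract (A * B' + A' * B)" unfolding AB by simp
    have "(v + w) * ev b c (B * B') = (v * ev b c B) * ev b c B' + (w * ev b c B') * ev b c B"
      by (simp add: algebra_simps ev.hom_mult)
    thus "(v + w) * ev b c (B * B') = ev b c (A * B' + A' * B)"
      unfolding AB by (simp add: ev.hom_mult ev.hom_add)
  qed
qed

lemma fract_value_mult:
  assumes "fract_value b c q v" "fract_value b c r w"
  shows "fract_value b c (q * r) (v * w)"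
proof -
  obtain A B A' B' where AB: "ev b c B \<noteq> 0" "q * to_fract B = to_fract A" "v * ev b c B = ev b c A"
    "ev b c B' \<noteq> 0" "r * to_fract B' = to_fract A'" "w * ev b c B' = ev b c A'"
    using assms unfolding fract_value_def by blast
  show ?thesis
  proof (rule fract_valueI)
    show "ev b c (B * B') \<noteq> 0" using AB by (simp add: ev.hom_mult)
    have "(q * r) * to_fract (B * B') = (q * to_fract B) * (r * to_fract B')"
      by (simp add: algebra_simps)
    thus "(q * r) * to_fract (B * B') = to_fract (A * A')" unfolding AB by simp
    have "(v * w) * ev b c (B * B') = (v * ev b c B) * (w * ev b c B')"
      by (simp add: algebra_simps ev.hom_mult)
    thus "(v * w) * ev b c (B * B') = ev b c (A * A')" unfolding AB by (simp add: ev.hom_mult)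
  qed
qed

lemma fract_value_minus_divide:
  assumes "fract_value b c q v" "ev b c S \<noteq> 0"
  shows "fract_value b c (- q / to_fract S) (- v / ev b c S)"
proof -
  obtain A B where AB: "ev b c B \<noteq> 0" "q * to_fract B = to_fract A" "v * ev b c B = ev b c A"
    using assms unfolding fract_value_def by blast
  have S: "to_fract S \<noteq> 0" using assms(2) by auto
  show ?thesis
  proof (rule fract_valueI)
    show "ev b c (S * B) \<noteq> 0" using AB assms by (simp add: ev.hom_mult)
    show "- q / to_fract S * to_fract (S * B) = to_fract (- A)"
      using S AB(2) by (simp add: field_simps)
    show "- v / ev b c S * ev b c (S * B) = ev b c (- A)"
      using AB(3) assms(2) by (simp add: ev.hom_mult ev.hom_uminus)
  qed
qed

interpretation fract_const: comm_ring_hom "\<lambda>c. to_fract [:[:c:]:] :: complex poly poly fract"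
  by unfold_locales (simp_all add: pCons_one flip: to_fract_add to_fract_mult)

lemma fract_value_mp_eval:
  assumes "mp_vars p \<subseteq> V" "\<And>i. i \<in> V \<Longrightarrow> fract_value b c (\<beta> i) (a i)"
  shows "fract_value b c (mp_eval (\<lambda>c. to_fract [:[:c:]:]) \<beta> p) (mp_eval fls_const a p)"
proof -
  interpret e: comm_ring_hom "mp_eval fls_const a"
    by (rule comm_ring_hom_mp_eval) (rule fls_const.comm_ring_hom_axioms)
  interpret f: comm_ring_hom "mp_eval (\<lambda>c. to_fract [:[:c:]:] :: complex poly poly fract) \<beta>"
    by (rule comm_ring_hom_mp_eval) (rule fract_const.comm_ring_hom_axioms)
  note [simp] = mp_eval_const[OF fls_const.comm_ring_hom_axioms] mp_eval_var[OF fls_const.comm_ring_hom_axioms]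
    mp_eval_const[OF fract_const.comm_ring_hom_axioms] mp_eval_var[OF fract_const.comm_ring_hom_axioms]
  show ?thesis using assms(1)
  proof (induction p rule: dpoly_induct)
    case (const k)
    show ?case using fract_value_to_fract[of b c "[:[:k:]:]"] by simp
  qed (auto simp: e.hom_add e.hom_mult f.hom_add f.hom_mult assms(2) intro: fract_value_add fract_value_mult)
qed

text \<open>With \<open>q = A / B = u / v\<close> one has \<open>u * B = A * v\<close>; the prime
  \<open>F\<close> divides \<open>A\<close>, which vanishes at the point, but not \<open>B\<close>,
  which does not.\<close>

lemma irreducible_dvd_numerator:
  assumes F: "Factorial_Ring.irreducible F" "ev b c F = 0" "nonconstant b" and q: "fract_value b c q 0"
  shows "F dvd fst (quot_of_fract q)"
proof -
  obtain A B where AB: "ev b c B \<noteq> 0" "q * to_fract B = to_fract A" "ev b c A = 0"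
    using q unfolding fract_value_def by auto
  have "F dvd A" using irreducible_dvd_if_ev_eq_0[OF F AB(3)] .
  have FB: "\<not> F dvd B" using AB(1) F(2) by (auto simp: dvd_def ev.hom_mult)
  define u v where "u = fst (quot_of_fract q)" and "v = snd (quot_of_fract q)"
  have "v \<noteq> 0" unfolding v_def by simp
  have "q = to_fract u / to_fract v" unfolding u_def v_def
    by (simp add: Fract_conv_to_fract[symmetric] Fract_quot_of_fract)
  hence "q * to_fract v = to_fract u" using \<open>v \<noteq> 0\<close> by simp
  hence "to_fract u * to_fract B = to_fract A * to_fract v"
    using AB(2) by (simp add: mult_ac flip: AB(2))
  hence "to_fract (u * B) = to_fract (A * v)" by simp
  hence "u * B = A * v" by (rule to_fract_eq_iff[THEN iffD1])
  hence "F dvd u * B" using \<open>F dvd A\<close> by simp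
  thus ?thesis using FB irreducible_imp_prime_elem[OF F(1)] unfolding u_def
    by (simp add: prime_elem_dvd_mult_iff)
qed

subsection \<open>The chain containing a solution\<close>

lemma ring_of_type_algebra_simps [simp]:
  "carrier (ring_of_type_algebra :: 'a::ring_1 ring) = UNIV"
  "(x :: 'a) \<otimes>\<^bsub>ring_of_type_algebra\<^esub> y = x * y"
  "x \<oplus>\<^bsub>ring_of_type_algebra\<^esub> y = x + y"
  "\<one>\<^bsub>ring_of_type_algebra\<^esub> = (1 :: 'a)"
  "\<zero>\<^bsub>ring_of_type_algebra\<^esub> = (0 :: 'a)"
  by (simp_all add: ring_of_type_algebra_def)

lemma eval_in_type_algebra:
  "eval_in (ring_of_type_algebra :: 'a::field ring) \<iota> a p = mp_eval \<iota> a p"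
proof -
  let ?K = "ring_of_type_algebra :: 'a ring"
  interpret K: field ?K by (rule field_from_type_algebra)
  have pow: "b [^]\<^bsub>?K\<^esub> (k :: nat) = b ^ k" for b k
    by (induction k) (simp_all add: mult.commute)
  have prod: "finprod ?K f A = prod f A" for f :: "nat \<Rightarrow> 'a" and A
    by (induction A rule: infinite_finite_induct) (simp_all add: Pi_def)
  have sum: "finsum ?K f A = sum f A" for f :: "(nat \<Rightarrow>\<^sub>0 nat) \<Rightarrow> 'a" and A
    by (induction A rule: infinite_finite_induct) (simp_all add: Pi_def)
  show ?thesis by (simp add: eval_in_def mp_eval_def pow prod sum)
qed

lemma fls_const_ring_hom: "fls_const \<in> Ring.ring_hom complex_ring (ring_of_type_algebra :: complex fls ring)"
  by (rule ring_hom_memI) (simp_all add: fls_plus_const)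

lemma zeros_type_algebra:
  "zeros (ring_of_type_algebra :: complex fls ring) fls_const m S =
     {a \<in> extensional {..m}. \<forall>p\<in>S. mp_eval fls_const a p = 0}"
  by (simp add: zeros_def eval_in_type_algebra PiE_def)

context puiseux
begin

text \<open>The decomposition is applied to the field of Laurent series and its point
  \<open>(y, y', ..., y^(m))\<close>.\<close>

lemma exists_chain_vanishing:
  assumes dec: "is_decomposition m S CS" and S: "\<forall>p\<in>S. mp_vars p \<subseteq> {..m}"
    and sol: "puiseux_solution pt n S y"
  shows "\<exists>C\<in>CS. \<forall>p\<in>set C. mp_eval fls_const (\<lambda>i. (D ^^ i) y) p = 0"
proof -
  let ?K = "ring_of_type_algebra :: complex fls ring"
  \<comment> \<open>Points of \<open>zeros\<close> are extensional on \<open>{..m}\<close>.\<close>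
  define a where "a = restrict (\<lambda>i. (D ^^ i) y) {..m}"
  have eq: "mp_eval fls_const a p = mp_eval fls_const (\<lambda>i. (D ^^ i) y) p" if "mp_vars p \<subseteq> {..m}" for p
    using that by (intro mp_eval_cong) (auto simp: a_def)
  have "a \<in> zeros ?K fls_const m S"
    unfolding zeros_type_algebra using S sol eq by (auto simp: a_def puiseux_solution_def)
  also have "zeros ?K fls_const m S =
      (\<Union>C\<in>CS. zeros ?K fls_const m (set C) - zeros ?K fls_const m {pinit C})"
    using dec fls_const_ring_hom field_from_type_algebra[where 'a = "complex fls"]
    unfolding is_decomposition_def by blast
  finally obtain C where C: "C \<in> CS" "a \<in> zeros ?K fls_const m (set C)" by blast
  hence "mp_eval fls_const (\<lambda>i. (D ^^ i) y) p = 0" if "p \<in> set C" for p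
    using dec that eq unfolding zeros_type_algebra is_decomposition_def by auto
  thus ?thesis using C by blast
qed

text \<open>A chain that starts in \<complex>[y] would provide a nonzero polynomial vanishing at the
  transcendental \<open>y\<close>.\<close>

lemma vanishing_chain_remaining:
  assumes dec: "is_decomposition m S CS" and C: "C \<in> CS"
    and van: "\<forall>p\<in>set C. mp_eval fls_const (\<lambda>i. (D ^^ i) y) p = 0" and y: "nonconstant y"
  shows "C \<in> remaining_chains CS"
proof -
  have False if ne: "C \<noteq> []" and uni: "mp_vars (hd C) \<subseteq> {0}"
  proof -
    have nz: "mp_vars (hd C) \<noteq> {}"
      using dec C ne by (auto simp: is_decomposition_def regular_chain_def)
    have v: "mp_vars (hd C) \<subseteq> {..1}" using uni by auto
    obtain q where q: "to_bivariate (hd C) = [:q:]"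
      using to_bivariate_univariate[OF uni] by (meson degree_eq_zeroE)
    have "ev y (D y) (to_bivariate (hd C)) = 0"
      using ev_to_bivariate[OF v, of "\<lambda>i. (D ^^ i) y"] van ne by simp
    hence "to_bivariate (hd C) = 0" using ev1_eq_0_iff[OF y] by (simp add: q)
    hence "hd C = 0" by (rule to_bivariate_eq_0[OF v])
    thus False using nz by simp
  qed
  thus ?thesis using C by (auto simp: remaining_chains_def)
qed

text \<open>Repeated differentiation of \<open>G(y, y') = 0\<close> gives
  \<open>S y^(j) + R_(j-1) = 0\<close> with a nonzero value of \<open>S\<close>; solving for
  \<open>y^(j)\<close> is the recursion of \<open>subst_B\<close>.\<close>

lemma fract_value_subst_B:
  assumes G: "mp_vars G \<subseteq> {..1}" "mp_eval fls_const (\<lambda>i. (D ^^ i) y) G = 0"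
    and S: "ev y (D y) (to_bivariate (mp_pderiv 1 G)) \<noteq> 0"
  shows "fract_value y (D y) (subst_B G i) ((D ^^ i) y)"
proof (induction i rule: less_induct)
  case (less i)
  consider "i = 0" | "i = 1" | k where "i = Suc (Suc k)"
    by (metis One_nat_def not0_implies_Suc)
  thus ?case
  proof cases
    case 1
    thus ?thesis using fract_value_to_fract[of y "D y" "[:[:0, 1:]:]"] by simp
  next
    case 2
    thus ?thesis using fract_value_to_fract[of y "D y" "[:0, 1:]"] by simp
  next
    case (3 k)
    let ?a = "\<lambda>i. (D ^^ i) y"
    let ?S = "ev y (D y) (to_bivariate (mp_pderiv 1 G))"
    interpret e: comm_ring_hom "mp_eval fls_const ?a"
      by (rule comm_ring_hom_mp_eval) (rule fls_const.comm_ring_hom_axioms)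
    have "mp_vars (mp_pderiv 1 G) \<subseteq> {..1}" using mp_vars_pderiv G(1) by (rule order.trans)
    hence eS: "?S = mp_eval fls_const ?a (mp_pderiv 1 G)"
      using ev_to_bivariate[of "mp_pderiv 1 G" ?a] by simp
    have "mp_eval fls_const ?a ((total_deriv ^^ k) G) = 0" for k
      by (induction k) (simp_all add: G(2) deriv_mp_eval[symmetric])
    hence "mp_eval fls_const ?a (mp_pderiv 1 G * mp_var i + deriv_rest G (Suc k)) = 0"
      using total_deriv_pow_rest[of "Suc k" G] 3 by metis
    hence "?S * ?a i + mp_eval fls_const ?a (deriv_rest G (Suc k)) = 0"
      unfolding e.hom_add e.hom_mult eS by (simp add: mp_eval_var[OF fls_const.comm_ring_hom_axioms])
    hence "?a i = - mp_eval fls_const ?a (deriv_rest G (Suc k)) / ?S"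
      using S by (simp add: field_simps eq_neg_iff_add_eq_0)
    \<comment> \<open>\<open>deriv_rest G (Suc k)\<close> involves variables up to
      \<open>k + 1\<close> only, so the substituted values are all of the form
      \<open>subst_B G i\<close>, never the default 0.\<close>
    moreover have "fract_value y (D y)
      (mp_eval (\<lambda>c. to_fract [:[:c:]:]) (\<lambda>i. if i < Suc (Suc k) then subst_B G i else 0) (deriv_rest G (Suc k)))
      (mp_eval fls_const ?a (deriv_rest G (Suc k)))"
      using mp_vars_deriv_rest[OF G(1), of k] by (rule fract_value_mp_eval) (use less 3 in auto)
    ultimately show ?thesis using fract_value_minus_divide[OF _ S] 3 by simp
  qed
qed

lemma irreducible_factor_reduced_ode:
  assumes m: "m > 0" and S: "\<forall>p\<in>S. mp_vars p \<subseteq> {..m}"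
    and adm: "admissible_decomposition m S CS"
    and y: "nonconstant y" and sol: "puiseux_solution pt n S y"
  shows "\<exists>F. Factorial_Ring.irreducible F \<and> ev y (D y) F = 0 \<and> nonconstant (D y) \<and>
    F dvd reduced_ode m CS \<and> reduced_ode m CS \<noteq> 0"
proof -
  have dec: "is_decomposition m S CS"
    and form: "\<And>C. C \<in> remaining_chains CS \<Longrightarrow> has_chain_form m C \<and> normalized_first (hd C)"
    using adm by (auto simp: admissible_decomposition_def)
  let ?a = "\<lambda>i. (D ^^ i) y"
  obtain C where C: "C \<in> CS" and van: "\<forall>p\<in>set C. mp_eval fls_const ?a p = 0"
    using exists_chain_vanishing[OF dec S sol] by blast
  have rem: "C \<in> remaining_chains CS" by (rule vanishing_chain_remaining[OF dec C van y])
  have chain: "has_chain_form m C" and norm: "normalized_first (hd C)" using form[OF rem] by auto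
  have len: "length C = m" using chain by (simp add: has_chain_form_def)
  have hd: "hd C = C ! 0" using len m by (cases C) auto
  have v: "mp_vars (hd C) \<subseteq> {..1}" 
    using chain m unfolding has_chain_form_def hd by (metis One_nat_def Suc_leI atLeastAtMost_iff diff_self_eq_0 order_refl)
  define P where "P = to_bivariate (hd C)"
  have hd0: "mp_eval fls_const ?a (hd C) = 0" using van len m by (metis hd_in_set length_greater_0_conv)
  hence P: "ev y (D y) P = 0" unfolding P_def using ev_to_bivariate[OF v, of ?a] by simp
  have sqf: "squarefree P" using norm by (simp add: normalized_first_def P_def)
  have nonconst: "nonconstant (D y)"
    using norm by (intro nonconstant_deriv[OF P y]) (simp add: normalized_first_def P_def)
  have S0: "ev y (D y) (to_bivariate (mp_pderiv 1 (hd C))) \<noteq> 0"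
    unfolding to_bivariate_pderiv P_def[symmetric] by (rule ev_pderiv_squarefree_nonzero[OF sqf P y])
  obtain F where F: "Factorial_Ring.irreducible F" "F dvd P" "ev y (D y) F = 0"
    using ev_irreducible_factor[OF complex_poly_poly_squarefree_nonzero[OF sqf] P] by blast
  have "F dvd reduced_H C j" if "j \<in> {1..m}" for j
  proof (cases "j = 1")
    case True
    thus ?thesis using F(2) by (simp add: reduced_H_def P_def)
  next
    case False
    have "C ! (j - 1) \<in> set C" using that len by auto
    hence 0: "mp_eval fls_const ?a (C ! (j - 1)) = 0" using van by blast
    have "fract_value y (D y) (mp_eval (\<lambda>c. to_fract [:[:c:]:]) (subst_B (hd C)) (C ! (j - 1)))
      (mp_eval fls_const ?a (C ! (j - 1)))"
      by (rule fract_value_mp_eval[OF subset_UNIV]) (rule fract_value_subst_B[OF v hd0 S0])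
    hence "F dvd fst (quot_of_fract (mp_eval (\<lambda>c. to_fract [:[:c:]:]) (subst_B (hd C)) (C ! (j - 1))))"
      unfolding 0 by (rule irreducible_dvd_numerator[OF F(1,3) y])
    thus ?thesis using False by (simp add: reduced_H_def)
  qed
  hence "F dvd chain_reduced_ode m C" unfolding chain_reduced_ode_def by (intro Gcd_greatest) auto
  also have "chain_reduced_ode m C dvd reduced_ode m CS"
    unfolding reduced_ode_def using rem by (intro dvd_Lcm) auto
  finally have "F dvd reduced_ode m CS" .
  \<comment> \<open>The gcd of each chain divides the square-free, hence nonzero,
    \<open>to_bivariate (hd C')\<close>, and the chains are finite in number. Divisibility bounds
    degrees only if \<open>H\<close> is nonzero.\<close>
  moreover have "reduced_ode m CS \<noteq> 0"
  proof -
    have "chain_reduced_ode m C' \<noteq> 0" if "C' \<in> remaining_chains CS" for C'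
    proof -
      have "to_bivariate (hd C') \<noteq> 0"
        using form[OF that] complex_poly_poly_squarefree_nonzero by (simp add: normalized_first_def)
      moreover have "chain_reduced_ode m C' dvd reduced_H C' 1"
        unfolding chain_reduced_ode_def using m by (intro Gcd_dvd) auto
      ultimately show ?thesis by (auto simp: reduced_H_def)
    qed
    moreover have "finite (remaining_chains CS)"
      using dec by (simp add: is_decomposition_def remaining_chains_def)
    ultimately show ?thesis unfolding reduced_ode_def by (subst Lcm_0_iff) auto
  qed
  ultimately show ?thesis using F nonconst by blast
qed

text \<open>In a factorization one factor has outer degree 0, so it divides both \<open>p\<close>
  and \<open>q\<close> and is a unit.\<close>

lemma irreducible_linear_coprime:
  fixes p q :: "complex poly"
  assumes "coprime p q" "q \<noteq> 0"
  shows "Factorial_Ring.irreducible [:-p, q:]"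
proof (rule Factorial_Ring.irreducibleI)
  show "\<not> is_unit [:-p, q:]" using assms(2) by (auto simp: is_unit_poly_iff)
  have const: "is_unit [:a:]" if "[:a:] dvd [:-p, q:]" for a
  proof -
    have "a dvd p" "a dvd q" using that[unfolded const_poly_dvd_iff, rule_format, of 0]
        that[unfolded const_poly_dvd_iff, rule_format, of 1] by auto
    hence "is_unit a" using assms(1) by (rule coprime_common_divisor[rotated 1])
    thus ?thesis by (simp add: is_unit_const_poly_iff)
  qed
  fix A B assume AB: "[:-p, q:] = A * B"
  have "A \<noteq> 0" "B \<noteq> 0" using AB assms(2) by auto
  hence "degree A + degree B = 1" using AB assms(2) by (metis degree_mult_eq degree_pCons_eq_if degree_0 One_nat_def
        pCons_eq_0_iff)
  hence "degree A = 0 \<or> degree B = 0" by linarith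
  thus "is_unit A \<or> is_unit B"
  proof
    assume "degree A = 0"
    then obtain a where "A = [:a:]" by (meson degree_eq_zeroE)
    thus ?thesis using const[of a] AB by (metis dvd_triv_left)
  next
    assume "degree B = 0"
    then obtain a where "B = [:a:]" by (meson degree_eq_zeroE)
    thus ?thesis using const[of a] AB by (metis dvd_triv_right)
  qed
qed (use assms in auto)

end

section \<open>Degree bounds for the minimal polynomial and for rational solutions\<close>

lemma eval_xY_eq_ev: "eval_xY pt n P y = ev (puiseux_x pt n) y P"
proof -
  have "eval_x pt n = ev1 (puiseux_x pt n)" by (rule ext) (simp add: eval_x_def ev1_def)
  thus ?thesis by (simp add: eval_xY_def ev_def)
qed

theorem theorem3p6:
  fixes m n :: nat
    and S :: "dpoly set"
    and CS :: "dpoly list set"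
    and pt :: expansion_point
    and y :: "complex fls"
    and H :: "complex poly poly"
  assumes "m > 0"
    and "finite S" and "\<forall>F\<in>S. mp_vars F \<subseteq> {..m}"
    and "alg_dim m (zeros complex_ring id m S) = 1"
    and "admissible_decomposition m S CS"
    and "H = reduced_ode m CS"
    and "n > 0"
    and "\<forall>c. y \<noteq> fls_const c"
    and "puiseux_solution pt n S y"
    and "algebraic_over_Cx pt n y"
  shows "(\<forall>G. is_minimal_polynomial pt n y G \<longrightarrow>
            inner_degree G \<le> outer_degree H \<and>
            outer_degree G \<le> inner_degree H + outer_degree H) \<and>
         (\<forall>p q. represents_quotient pt n y p q \<longrightarrow>
            max (Polynomial.degree p) (Polynomial.degree q) \<le> outer_degree H)"
proof -
  interpret puiseux pt n using assms(7) by unfold_locales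
  have y: "nonconstant y" using assms(8) by (simp add: nonconstant_def)
  obtain F where F: "Factorial_Ring.irreducible F" "ev y (D y) F = 0" "nonconstant (D y)"
    "F dvd H" "H \<noteq> 0"
    using irreducible_factor_reduced_ode[OF assms(1,3,5) y assms(9)] assms(6) by blast
  have le: "inner_degree F \<le> inner_degree H" "outer_degree F \<le> outer_degree H"
    using F by (auto intro: inner_degree_dvd outer_degree_dvd)
  have bounds: "inner_degree G \<le> outer_degree H" "outer_degree G \<le> inner_degree H + outer_degree H"
    if "Factorial_Ring.irreducible G" "ev x y G = 0" for G
    using minimal_polynomial_degree_bounds[OF y F(3,1,2) that] le by auto
  have "max (degree p) (degree q) \<le> outer_degree H" if "represents_quotient pt n y p q" for p q
  proof -
    have pq: "q \<noteq> 0" "coprime p q" "y = ev1 x p / ev1 x q"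
      using that by (simp_all add: represents_quotient_def eval_x_def ev1_def)
    have "ev1 x q \<noteq> 0" using pq(1) by (simp add: ev1_eq_0_iff[OF nonconstant_x])
    \<comment> \<open>For \<open>y = p / q\<close> the minimal polynomial is \<open>q Y - p\<close>,
      whose inner degree bounds the degrees of both \<open>p\<close> and \<open>q\<close>.\<close>
    hence "ev x y [:-p, q:] = 0" using pq(3) by (simp add: ev1.hom_uminus)
    hence "inner_degree [:-p, q:] \<le> outer_degree H"
      using bounds(1) irreducible_linear_coprime[OF pq(2,1)] by blast
    moreover have "degree p \<le> inner_degree [:-p, q:]" "degree q \<le> inner_degree [:-p, q:]"
      using degree_coeff_le_inner_degree[of "[:-p, q:]" 0] degree_coeff_le_inner_degree[of "[:-p, q:]" 1] by simp_all
    ultimately show ?thesis by simp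
  qed
  thus ?thesis using bounds by (auto simp: is_minimal_polynomial_def eval_xY_eq_ev)
qed

end
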